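(* For all $n \in \mathbb{N}$, $$\overline{NT}(1,3,3n)-\overline{NT}(2,3,3n)\equiv\overline{NT2}(1,3,3n)-\overline{NT2}(2,3,3n)\pmod{3}$$ and $$\overline{NT}(1,3,3n+1)-\overline{NT}(2,3,3n+1)\equiv\overline{NT2}(1,3,3n+1)-\overline{NT2}(2,3,3n+1) \pmod{3}.$$
   Context: $\mathbb{N}=\{0,1,2,\dots\}$. A partition of $n$ is a non-increasing sequence of positive integers (its parts) whose sum is $n$. An overpartition of $n$ is a partition of $n$ in which the first occurrence of each number may (or may not) be overlined (e.g. there are 14 overpartitions of $4$). For an overpartition $\pi$, let $\ell(\pi)$ be the (size of the) largest part and $n(\pi)$ the number of parts. The (Dyson) rank of $\pi$ is $\ell(\pi)-n(\pi)$. Let $\pi_o$ be the subpartition consisting of the odd non-overlined parts of $\pi$ (so $n(\pi_o)$ is the number of odd non-overlined parts), and let $\chi(\pi)=1$ if the largest part of $\pi$ is odd and non-overlined and $\chi(\pi)=0$ otherwise; here an overlined part $\overline{k}$ is regarded as larger than a non-overlined part $k$ of the same size, so the largest part is the first part in the sequence. The $M_2$-rank of $\pi$ is $$\text{$M_2$-rank}(\pi) = \left\lceil \frac{\ell(\pi)}{2}\right\rceil - n(\pi) + n(\pi_o) - \chi(\pi).$$ $\overline{NT}(b,k,n)$ denotes the total number of parts in the overpartitions of $n$ with rank congruent to $b$ modulo $k$ (the sum of $n(\pi)$ over all such overpartitions $\pi$), and $\overline{NT2}(b,k,n)$ denotes the total number of parts in the overpartitions of $n$ with $M_2$-rank congruent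 to $b$ modulo $k$. *)

theory Defs
  imports Complex_Main "HOL-Number_Theory.Cong"
begin

text \<open>
  An overpartition is the list of its parts in non-increasing order. A part is a pair
  \<open>(k, b)\<close> of its size \<open>k\<close> and a flag \<open>b\<close> telling whether it is overlined. As only the first
  occurrence of each size may be overlined, an overlined part precedes the non-overlined parts
  of the same size.
\<close>

type_synonym part = "nat \<times> bool"

abbreviation part_size :: "part \<Rightarrow> nat" where
  "part_size \<equiv> fst"

abbreviation overlined :: "part \<Rightarrow> bool" where
  "overlined \<equiv> snd"

definition overpartition :: "nat \<Rightarrow> part list \<Rightarrow> bool" where
  "overpartition n \<pi> \<longleftrightarrow>
     sorted_wrt (\<ge>) (map part_size \<pi>) \<and>
     (\<forall>p \<in> set \<pi>. part_size p > 0) \<and>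
     sum_list (map part_size \<pi>) = n \<and>
     (\<forall>i < length \<pi>. overlined (\<pi> ! i) \<longrightarrow> (\<forall>j < i. part_size (\<pi> ! j) \<noteq> part_size (\<pi> ! i)))"

definition overpartitions :: "nat \<Rightarrow> part list set" where
  "overpartitions n = {\<pi>. overpartition n \<pi>}"

text \<open>The largest part of the empty overpartition has size 0 by convention.\<close>

definition largest_part :: "part list \<Rightarrow> nat" where
  "largest_part \<pi> = (if \<pi> = [] then 0 else part_size (hd \<pi>))"

definition num_parts :: "part list \<Rightarrow> nat" where
  "num_parts \<pi> = length \<pi>"

definition odd_nonoverlined :: "part \<Rightarrow> bool" where
  "odd_nonoverlined p \<longleftrightarrow> odd (part_size p) \<and> \<not> overlined p"

definition odd_nonoverlined_parts :: "part list \<Rightarrow> part list" where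
  "odd_nonoverlined_parts \<pi> = filter odd_nonoverlined \<pi>"

definition chi :: "part list \<Rightarrow> int" where
  "chi \<pi> = (if \<pi> \<noteq> [] \<and> odd_nonoverlined (hd \<pi>) then 1 else 0)"

definition dyson_rank :: "part list \<Rightarrow> int" where
  "dyson_rank \<pi> = int (largest_part \<pi>) - int (num_parts \<pi>)"

definition M2_rank :: "part list \<Rightarrow> int" where
  "M2_rank \<pi> = \<lceil>real (largest_part \<pi>) / 2\<rceil> - int (num_parts \<pi>)
     + int (num_parts (odd_nonoverlined_parts \<pi>)) - chi \<pi>"

definition NT_bar :: "int \<Rightarrow> int \<Rightarrow> nat \<Rightarrow> int" where
  "NT_bar b k n = (\<Sum>\<pi> | \<pi> \<in> overpartitions n \<and> [dyson_rank \<pi> = b] (mod k). int (num_parts \<pi>))"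

definition NT2_bar :: "int \<Rightarrow> int \<Rightarrow> nat \<Rightarrow> int" where
  "NT2_bar b k n = (\<Sum>\<pi> | \<pi> \<in> overpartitions n \<and> [M2_rank \<pi> = b] (mod k). int (num_parts \<pi>))"

text \<open>The sums above range over finite sets.\<close>

lemma finite_overpartitions: "finite (overpartitions n)"
proof (rule finite_subset)
  show "overpartitions n \<subseteq> {xs. set xs \<subseteq> {..n} \<times> UNIV \<and> length xs \<le> n}"
  proof
    fix xs assume "xs \<in> overpartitions n"
    then have pos: "\<forall>p \<in> set xs. fst p > 0" and s: "sum_list (map fst xs) = n"
      by (auto simp: overpartitions_def overpartition_def)
    have "length xs \<le> sum_list (map fst xs)"
      using pos by (induction xs) (simp_all add: Suc_le_eq add_less_le_mono)
    moreover have "set xs \<subseteq> {..n} \<times> UNIV"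
    proof
      fix p assume "p \<in> set xs"
      then have "fst p \<in> set (map fst xs)" by simp
      then have "fst p \<le> n"
        using member_le_sum_list s by blast
      then show "p \<in> {..n} \<times> UNIV" by (cases p) auto
    qed
    ultimately show "xs \<in> {xs. set xs \<subseteq> {..n} \<times> UNIV \<and> length xs \<le> n}"
      using s by simp
  qed
  show "finite {xs. set xs \<subseteq> {..n} \<times> (UNIV :: bool set) \<and> length xs \<le> n}"
    by (intro finite_lists_length_le) auto
qed

end

theory Submission
  imports Defs "HOL-Library.Multiset" "HOL-Computational_Algebra.Formal_Power_Series"
begin

text \<open>
  Write \<open>n\<close>, \<open>l\<close>, \<open>n\<^sub>o\<close> for the number of parts, the largest part and the number of odd
  non-overlined parts. Modulo 3, the difference of the counts for residues 1 and 2 is the sum of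
  \<open>n\<close> times the rank. Switching the overline of the largest part shows that twice the difference of
  the two sides is the sum of \<open>n (l - 2 n\<^sub>o)\<close>. Let \<open>P\<close> be the generating function of overpartitions.
  Dyson's recurrence for the numbers of overpartitions with rank at least \<open>m\<close>, together with conjugation,
  gives both \<open>P \<theta> = 1\<close> for \<open>\<theta> = \<Sum> (-1)\<^sup>x q\<^bsup>x\<^sup>2\<^esup>\<close> and the generating function of \<open>n (l - n)\<close>; that of
  \<open>n (n - 2 n\<^sub>o)\<close> is found by removing copies of one part. Together they give \<open>P U\<close> where the coefficient of
  \<open>q\<^sup>i\<close> in \<open>U\<close> is congruent to the sum of \<open>(-1)\<^sup>e (d - e)\<close> over the factorisations \<open>i = d e\<close> with \<open>d < e\<close>.

  Split \<open>\<theta> = a + b\<close> and \<open>U = U\<^sub>0 + U\<^sub>1 + U\<^sub>2\<close> by the exponents modulo 3. As \<open>U\<^sub>1\<close> vanishes modulo 3, so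
  do the required coefficients of \<open>P U\<close> once \<open>a U\<^sub>0 - b U\<^sub>2\<close> does. The coefficient of the latter at a
  multiple \<open>N\<close> of 3 is a signed sum of a genus character over the indefinite forms
  \<open>d u\<^sup>2 + 2 x u v - e v\<^sup>2\<close> with \<open>x\<^sup>2 + d e = N\<close> and \<open>0 < d < e\<close>, and a few substitutions under which
  the character is invariant or changes sign show that this sum is divisible by 3.
\<close>

unbundle fps_syntax

section \<open>Overpartitions as multisets\<close>

text \<open>The keys order the parts as they are listed in an overpartition, so the multiset of keys determines
  the overpartition. Odd keys belong to overlined parts.\<close>

definition part_key :: "part \<Rightarrow> nat" where
  "part_key p = 2 * part_size p + of_bool (overlined p)"

definition over_msets :: "nat \<Rightarrow> nat multiset set" where
  "over_msets N = {M. (\<forall>\<kappa> \<in># M. 2 \<le> \<kappa>) \<and> (\<forall>\<kappa>. odd \<kappa> \<longrightarrow> count M \<kappa> \<le> 1) \<and> (\<Sum>\<kappa>\<in>#M. \<kappa> div 2) = N}"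

definition key_mset :: "part list \<Rightarrow> nat multiset" where
  "key_mset \<pi> = mset (map part_key \<pi>)"

definition largest :: "nat multiset \<Rightarrow> nat" where
  "largest M = (if M = {#} then 0 else Max_mset M div 2)"

text \<open>The keys of the odd non-overlined parts are those congruent to 2 modulo 4.\<close>

definition num_odd :: "nat multiset \<Rightarrow> nat" where
  "num_odd M = size {#\<kappa> \<in># M. \<kappa> mod 4 = 2#}"

lemma part_key_div [simp]: "part_key p div 2 = part_size p"
  by (simp add: part_key_def)

lemma odd_part_key [simp]: "odd (part_key p) \<longleftrightarrow> overlined p"
  by (simp add: part_key_def)

lemma part_key_decode [simp]: "part_key (\<kappa> div 2, odd \<kappa>) = \<kappa>"
  by (simp add: part_key_def)

lemma inj_part_key: "inj part_key"
  proof (rule injI)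
  fix p q assume "part_key p = part_key q"
  then have "part_key p div 2 = part_key q div 2" "odd (part_key p) = odd (part_key q)" by simp_all
  then have "fst p = fst q" "snd p = snd q" by (simp_all only: part_key_div odd_part_key)
  then show "p = q" by (rule prod_eqI)
qed

text \<open>Ties are allowed only at even keys, so an odd key never meets an equal one. This
  separates the order of the list from a condition on multiplicities, which depends only on the
  multiset.\<close>

lemma sorted_keys_iff:
  "sorted_wrt (\<lambda>a b. b < a \<or> a = b \<and> even b) xs \<longleftrightarrow>
     sorted_wrt (\<ge>) xs \<and> (\<forall>\<kappa>::nat. odd \<kappa> \<longrightarrow> count (mset xs) \<kappa> \<le> 1)"
proof (induction xs)
  case (Cons a xs)
  have "(\<forall>b\<in>set xs. b < a \<or> a = b \<and> even b) \<longleftrightarrow> (\<forall>b\<in>set xs. b \<le> a) \<and> (odd a \<longrightarrow> count (mset xs) a = 0)"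
    by (auto simp: count_eq_zero_iff order_le_less)
  moreover have "(\<forall>\<kappa>. odd \<kappa> \<longrightarrow> count (mset (a # xs)) \<kappa> \<le> 1) \<longleftrightarrow>
     (\<forall>\<kappa>. odd \<kappa> \<longrightarrow> count (mset xs) \<kappa> \<le> 1) \<and> (odd a \<longrightarrow> count (mset xs) a = 0)"
  proof -
    have "count (mset (a # xs)) \<kappa> = of_bool (\<kappa> = a) + count (mset xs) \<kappa>" for \<kappa> by simp
    then have "count (mset (a # xs)) \<kappa> \<le> 1 \<longleftrightarrow> count (mset xs) \<kappa> \<le> 1 \<and> (\<kappa> = a \<longrightarrow> count (mset xs) a = 0)" for \<kappa>
      by (cases "\<kappa> = a") (simp_all only: of_bool_eq simp_thms, arith+)
    then show ?thesis by blast
  qed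
  ultimately show ?case using Cons.IH by (simp only: sorted_wrt.simps) blast
qed simp

text \<open>The size and overline conditions both concern pairs of positions, and for a pair they
  amount to one comparison of keys: a later part of equal size must be non-overlined, and then its
  key is not larger.\<close>

lemma overpartition_iff_sorted:
  "overpartition N \<pi> \<longleftrightarrow>
     sorted_wrt (\<lambda>a b. b < a \<or> a = b \<and> even b) (map part_key \<pi>) \<and>
     (\<forall>p \<in> set \<pi>. part_size p > 0) \<and> sum_list (map part_size \<pi>) = N"
proof -
  have R: "(part_key q < part_key p \<or> part_key p = part_key q \<and> even (part_key q)) \<longleftrightarrow>
      part_size q \<le> part_size p \<and> (overlined q \<longrightarrow> part_size p \<noteq> part_size q)" for p q
    by (cases p; cases q) (auto simp: part_key_def)
  show ?thesis
    unfolding overpartition_def sorted_wrt_iff_nth_less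
    using R by (auto simp: less_imp_le)
qed

lemma key_mset_in_over_msets:
  assumes "\<pi> \<in> overpartitions N" shows "key_mset \<pi> \<in> over_msets N"
proof -
  have "overpartition N \<pi>" using assms by (simp add: overpartitions_def)
  then have *: "sorted_wrt (\<ge>) (map part_key \<pi>)" "\<forall>\<kappa>. odd \<kappa> \<longrightarrow> count (key_mset \<pi>) \<kappa> \<le> 1"
     "\<forall>p \<in> set \<pi>. part_size p > 0" "sum_list (map part_size \<pi>) = N"
    unfolding overpartition_iff_sorted sorted_keys_iff key_mset_def by blast+
  have "(\<Sum>\<kappa>\<in>#key_mset \<pi>. \<kappa> div 2) = sum_list (map (\<lambda>p. part_key p div 2) \<pi>)"
    unfolding key_mset_def by (induction \<pi>) auto
  moreover have "2 \<le> \<kappa>" if "\<kappa> \<in># key_mset \<pi>" for \<kappa>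
  proof -
    have "\<kappa> \<in> part_key ` set \<pi>" using that by (simp add: key_mset_def)
    then obtain p where p: "p \<in> set \<pi>" "\<kappa> = part_key p" by blast
    then have "0 < part_size p" using *(3) by blast
    then show ?thesis using p by (simp add: part_key_def)
  qed
  moreover have "(\<Sum>p\<leftarrow>\<pi>. part_key p div 2) = N" using *(4) by simp
  ultimately show ?thesis using *(2) unfolding over_msets_def by blast
qed

lemma sorted_keys: "\<pi> \<in> overpartitions N \<Longrightarrow> sorted_wrt (\<ge>) (map part_key \<pi>)"
  unfolding overpartitions_def mem_Collect_eq overpartition_iff_sorted sorted_keys_iff by blast

lemma sorted_mset_eq: "sorted xs \<Longrightarrow> sorted ys \<Longrightarrow> mset xs = mset ys \<Longrightarrow> xs = ys"
  by (metis properties_for_sort)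

lemma bij_key_mset: "bij_betw key_mset (overpartitions N) (over_msets N)"
proof (rule bij_betw_imageI)
  have sd: "sorted (rev (map part_key \<pi>))" if "\<pi> \<in> overpartitions N" for \<pi>
    using sorted_keys[OF that] by (simp add: sorted_wrt_rev)
  show "inj_on key_mset (overpartitions N)"
  proof (rule inj_onI)
    fix \<pi> \<pi>' assume "\<pi> \<in> overpartitions N" "\<pi>' \<in> overpartitions N" "key_mset \<pi> = key_mset \<pi>'"
    then have "rev (map part_key \<pi>) = rev (map part_key \<pi>')"
      using sd by (intro sorted_mset_eq) (simp_all only: key_mset_def mset_rev)
    then show "\<pi> = \<pi>'" using inj_part_key by (simp add: inj_map_eq_map)
  qed
  have "M \<in> key_mset ` overpartitions N" if M: "M \<in> over_msets N" for M
  proof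
    define xs where "xs = rev (sorted_list_of_multiset M)"
    define \<pi> where "\<pi> = map (\<lambda>\<kappa>. (\<kappa> div 2, odd \<kappa>)) xs"
    have m: "map part_key \<pi> = xs" unfolding \<pi>_def by (simp add: comp_def)
    have mx: "mset xs = M" by (simp add: xs_def)
    have sx: "sorted_wrt (\<ge>) xs" by (simp add: xs_def sorted_wrt_rev)
    have "sum_list (map part_size \<pi>) = (\<Sum>\<kappa>\<in>#M. \<kappa> div 2)"
      by (simp add: \<pi>_def comp_def mx[symmetric] sum_mset_sum_list[symmetric])
    moreover have "part_size p > 0" if p: "p \<in> set \<pi>" for p
    proof -
      have "part_key p \<in># M" using p m mx by (metis list.set_map imageI set_mset_mset)
      then have "2 \<le> part_key p" using M by (auto simp: over_msets_def)
      then show ?thesis by (metis part_key_div div_greater_zero_iff zero_less_numeral)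
    qed
    ultimately show "\<pi> \<in> overpartitions N"
      using M sx unfolding overpartitions_def mem_Collect_eq overpartition_iff_sorted m sorted_keys_iff mx
      by (simp add: over_msets_def)
    show "M = key_mset \<pi>" by (simp add: key_mset_def m mx)
  qed
  then show "key_mset ` overpartitions N = over_msets N" using key_mset_in_over_msets by blast
qed

lemma size_key_mset [simp]: "size (key_mset \<pi>) = length \<pi>"
  by (simp add: key_mset_def)

lemma largest_key_mset:
  assumes "\<pi> \<in> overpartitions N" shows "largest (key_mset \<pi>) = largest_part \<pi>"
proof (cases \<pi>)
  case (Cons p \<pi>')
  note srt = sorted_keys[OF assms]
  then have "Max_mset (key_mset \<pi>) = part_key p"
    using srt unfolding key_mset_def by (intro Max_eqI) (fastforce simp: Cons)+
  then have "Max_mset (key_mset \<pi>) div 2 = part_size p" by simp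
  moreover have "key_mset \<pi> \<noteq> {#}" by (simp add: key_mset_def Cons)
  ultimately show ?thesis by (simp add: largest_def largest_part_def Cons)
qed (simp add: largest_def largest_part_def key_mset_def)

lemma num_odd_key_mset: "num_odd (key_mset \<pi>) = num_parts (odd_nonoverlined_parts \<pi>)"
proof -
  have "part_key p mod 4 = 2 \<longleftrightarrow> odd_nonoverlined p" for p
  proof -
    have "(2 * k + 1) mod 4 \<noteq> 2" for k :: nat by presburger
    moreover have "2 * k mod 4 = 2 \<longleftrightarrow> odd k" for k :: nat by presburger
    ultimately show ?thesis
      by (cases "overlined p") (simp_all add: odd_nonoverlined_def part_key_def)
  qed
  then show ?thesis
    unfolding num_odd_def key_mset_def num_parts_def odd_nonoverlined_parts_def
    by (induction \<pi>) auto
qed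

lemma sum_overpartitions:
  "(\<Sum>\<pi>\<in>overpartitions N. F (largest_part \<pi>) (num_parts \<pi>) (num_parts (odd_nonoverlined_parts \<pi>))) =
     (\<Sum>M\<in>over_msets N. F (largest M) (size M) (num_odd M))"
proof -
  have "(\<Sum>M\<in>over_msets N. F (largest M) (size M) (num_odd M)) =
      (\<Sum>\<pi>\<in>overpartitions N. F (largest (key_mset \<pi>)) (size (key_mset \<pi>)) (num_odd (key_mset \<pi>)))"
    by (rule sum.reindex_bij_betw[OF bij_key_mset, symmetric])
  also have "\<dots> = (\<Sum>\<pi>\<in>overpartitions N. F (largest_part \<pi>) (num_parts \<pi>) (num_parts (odd_nonoverlined_parts \<pi>)))"
  proof (rule sum.cong[OF refl])
    fix \<pi> assume "\<pi> \<in> overpartitions N"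
    then show "F (largest (key_mset \<pi>)) (size (key_mset \<pi>)) (num_odd (key_mset \<pi>)) =
        F (largest_part \<pi>) (num_parts \<pi>) (num_parts (odd_nonoverlined_parts \<pi>))"
      by (simp only: largest_key_mset num_odd_key_mset num_parts_def size_key_mset)
  qed
  finally show ?thesis by simp
qed

lemma finite_over_msets: "finite (over_msets N)"
  using bij_betw_finite[OF bij_key_mset] finite_overpartitions by blast

section \<open>Overpartitions in a box\<close>

lemma add_mset_over_msets:
  assumes "2 \<le> \<kappa>"
  shows "add_mset \<kappa> M \<in> over_msets N \<longleftrightarrow>
    \<kappa> div 2 \<le> N \<and> M \<in> over_msets (N - \<kappa> div 2) \<and> (odd \<kappa> \<longrightarrow> \<kappa> \<notin># M)"
proof -
  have "(\<forall>\<nu>. odd \<nu> \<longrightarrow> count (add_mset \<kappa> M) \<nu> \<le> 1) \<longleftrightarrow>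
        (\<forall>\<nu>. odd \<nu> \<longrightarrow> count M \<nu> \<le> 1) \<and> (odd \<kappa> \<longrightarrow> \<kappa> \<notin># M)"
  proof -
    have "count (add_mset \<kappa> M) \<nu> \<le> 1 \<longleftrightarrow> count M \<nu> \<le> 1 \<and> (\<nu> = \<kappa> \<longrightarrow> \<kappa> \<notin># M)" for \<nu>
      by (auto simp: not_in_iff)
    then show ?thesis by blast
  qed
  moreover have "(\<Sum>\<nu>\<in>#add_mset \<kappa> M. \<nu> div 2) = N \<longleftrightarrow>
      \<kappa> div 2 \<le> N \<and> (\<Sum>\<nu>\<in>#M. \<nu> div 2) = N - \<kappa> div 2"
    by auto
  ultimately show ?thesis
    using assms unfolding over_msets_def by auto
qed

text \<open>Removing one copy of \<open>\<kappa>\<close> is injective. An odd key occurs at most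
  once, so what remains must then avoid it; an even key imposes no such restriction.\<close>

lemma sum_over_msets_mem:
  fixes f :: "nat multiset \<Rightarrow> int"
  assumes "2 \<le> \<kappa>"
  shows "(\<Sum>M\<in>over_msets N. of_bool (\<kappa> \<in># M) * f M) =
    (if \<kappa> div 2 \<le> N then \<Sum>M\<in>over_msets (N - \<kappa> div 2). of_bool (odd \<kappa> \<longrightarrow> \<kappa> \<notin># M) * f (add_mset \<kappa> M) else 0)"
proof -
  define S where "S = {M \<in> over_msets (N - \<kappa> div 2). odd \<kappa> \<longrightarrow> \<kappa> \<notin># M}"
  have "(\<Sum>M\<in>over_msets N. of_bool (\<kappa> \<in># M) * f M) = (\<Sum>M\<in>{M \<in> over_msets N. \<kappa> \<in># M}. f M)"
    by (simp add: sum.inter_filter finite_over_msets of_bool_def if_distrib[where f="\<lambda>x. x * _"] cong: if_cong)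
  also have "{M \<in> over_msets N. \<kappa> \<in># M} = (if \<kappa> div 2 \<le> N then add_mset \<kappa> ` S else {})"
  proof -
    have "M \<in> over_msets N \<and> \<kappa> \<in># M \<longleftrightarrow> M \<in> (if \<kappa> div 2 \<le> N then add_mset \<kappa> ` S else {})" for M
    proof (cases "\<kappa> \<in># M")
      case True
      then obtain M' where M': "M = add_mset \<kappa> M'" by (rule mset_add)
      then show ?thesis by (auto simp: add_mset_over_msets[OF assms] S_def)
    qed auto
    then show ?thesis by blast
  qed
  also have "(\<Sum>M\<in>\<dots>. f M) = (if \<kappa> div 2 \<le> N then \<Sum>M\<in>S. f (add_mset \<kappa> M) else 0)"
    by (simp add: sum.reindex inj_on_def comp_def)
  also have "(\<Sum>M\<in>S. f (add_mset \<kappa> M)) =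
      (\<Sum>M\<in>over_msets (N - \<kappa> div 2). of_bool (odd \<kappa> \<longrightarrow> \<kappa> \<notin># M) * f (add_mset \<kappa> M))"
    unfolding S_def
    by (simp only: sum.inter_filter finite_over_msets of_bool_def if_distrib[where f="\<lambda>x. x * _"] mult_1 mult_zero_left cong: if_cong)
  finally show ?thesis .
qed

lemma largest_le_iff: "largest M \<le> L \<longleftrightarrow> (\<forall>\<kappa>\<in>#M. \<kappa> div 2 \<le> L)"
proof (cases "M = {#}")
  case False
  then have "Max_mset M \<in># M" "\<And>\<kappa>. \<kappa> \<in># M \<Longrightarrow> \<kappa> \<le> Max_mset M" by simp_all
  moreover have "largest M = Max_mset M div 2" using False by (simp add: largest_def)
  ultimately show ?thesis by (metis div_le_mono order_trans)
qed (simp add: largest_def)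

lemma size_le: assumes "M \<in> over_msets N" shows "size M \<le> N"
proof -
  have "size M = (\<Sum>\<kappa>\<in>#M. 1)" by simp
  also have "\<dots> \<le> (\<Sum>\<kappa>\<in>#M. \<kappa> div 2)"
  proof (rule sum_mset_mono)
    fix \<kappa> assume "\<kappa> \<in># M"
    then have "2 \<le> \<kappa>" using assms by (auto simp: over_msets_def)
    then show "1 \<le> \<kappa> div 2" by linarith
  qed
  finally show ?thesis using assms by (simp add: over_msets_def)
qed

lemma part_le: assumes "M \<in> over_msets N" "\<kappa> \<in># M" shows "\<kappa> div 2 \<le> N"
proof -
  obtain M' where "M = add_mset \<kappa> M'" using assms(2) by (rule mset_add)
  then show ?thesis using assms(1) by (auto simp: over_msets_def)
qed

lemma largest_le: "M \<in> over_msets N \<Longrightarrow> largest M \<le> N"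
  using part_le largest_le_iff by blast

lemma largest_pos: assumes "M \<in> over_msets N" "M \<noteq> {#}" shows "0 < largest M"
proof -
  have "Max_mset M \<in># M" using assms(2) by simp
  then have "2 \<le> Max_mset M" using assms(1) by (auto simp: over_msets_def)
  then show ?thesis using assms(2) by (simp add: largest_def)
qed

text \<open>An overpartition analogue of the Gaussian binomial coefficients: the Ferrers diagram has
  to fit into \<open>n\<close> rows of length \<open>L\<close>.\<close>

definition boxed :: "nat \<Rightarrow> nat \<Rightarrow> int fps" where
  "boxed L n = Abs_fps (\<lambda>N. \<Sum>M\<in>over_msets N. of_bool (largest M \<le> L \<and> size M \<le> n))"

lemma boxed_nth: "boxed L n $ N = (\<Sum>M\<in>over_msets N. of_bool (largest M \<le> L \<and> size M \<le> n))"
  by (simp add: boxed_def)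

lemma over_msets_0: "over_msets 0 = {{#}}"
proof -
  have "M = {#}" if "M \<in> over_msets 0" for M using size_le[OF that] by simp
  moreover have "{#} \<in> over_msets 0" by (simp add: over_msets_def)
  ultimately show ?thesis by blast
qed

lemma empty_over_msets [simp]: "{#} \<in> over_msets N \<longleftrightarrow> N = 0"
  by (auto simp: over_msets_def)

lemma sum_empty:
  "(\<Sum>M\<in>over_msets N. of_bool (M = {#}) :: int) = of_bool (N = 0)"
proof (cases "N = 0")
  case False
  then have "M \<noteq> {#}" if "M \<in> over_msets N" for M using that by auto
  then show ?thesis using False by simp
qed (simp add: over_msets_0)

lemma boxed_0_right: "boxed L 0 = 1"
proof (rule fps_ext)
  fix N
  have "largest M \<le> L \<and> size M \<le> 0 \<longleftrightarrow> M = {#}" for M by (auto simp: largest_def)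
  then show "boxed L 0 $ N = 1 $ N" using sum_empty by (simp add: boxed_nth)
qed

lemma boxed_0_left: "boxed 0 n = 1"
proof (rule fps_ext)
  fix N
  have "boxed 0 n $ N = (\<Sum>M\<in>over_msets N. of_bool (M = {#}))"
    unfolding boxed_nth
  proof (rule sum.cong[OF refl])
    fix M assume "M \<in> over_msets N"
    then have "largest M \<le> 0 \<and> size M \<le> n \<longleftrightarrow> M = {#}" 
      using largest_pos[of M N] by (auto simp: largest_def)
    then show "of_bool (largest M \<le> 0 \<and> size M \<le> n) = (of_bool (M = {#}) :: int)" by simp
  qed
  then show "boxed 0 n $ N = 1 $ N" using sum_empty by simp
qed

text \<open>Three cases for the parts of size \<open>Suc L\<close>: there are none; a non-overlined
  one is removed, and others may remain; or the overlined one stands alone, and its removal leaves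
  parts of size at most \<open>L\<close>.\<close>

lemma boxed_rec_row:
  "boxed (Suc L) (Suc n) = boxed L (Suc n) + fps_X ^ Suc L * (boxed (Suc L) n + boxed L n)"
proof (rule fps_ext)
  fix N
  define B where "B L n M = (of_bool (largest M \<le> L \<and> size M \<le> n) :: int)" for L n and M :: "nat multiset"
  \<comment> \<open>The keys of the non-overlined and the overlined part of size
    \<open>Suc L\<close>.\<close>
  define e where "e = 2 * Suc L"
  define o' where "o' = Suc e"
  have e: "2 \<le> e" "e div 2 = Suc L" "\<not> odd e" and o': "2 \<le> o'" "o' div 2 = Suc L" "odd o'"
    by (simp_all add: e_def o'_def)
  have split: "B L n M = of_bool (o' \<notin># M) * (of_bool (e \<notin># M) * B (Suc L) n M)" for n M
  proof -
    have "\<kappa> div 2 \<le> L \<longleftrightarrow> \<kappa> div 2 \<le> Suc L \<and> \<kappa> \<noteq> e \<and> \<kappa> \<noteq> o'" for \<kappa>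
      unfolding e_def o'_def by presburger
    then have "largest M \<le> L \<longleftrightarrow> largest M \<le> Suc L \<and> e \<notin># M \<and> o' \<notin># M"
      unfolding largest_le_iff by blast
    then show ?thesis by (auto simp: B_def)
  qed
  have B_add_e: "B (Suc L) (Suc n) (add_mset e M) = B (Suc L) n M"
    and B_add_o: "B (Suc L) (Suc n) (add_mset o' M) = B (Suc L) n M" for M
    unfolding B_def largest_le_iff by (simp_all add: e(2) o'(2))
  have "boxed (Suc L) (Suc n) $ N = (\<Sum>M\<in>over_msets N. B (Suc L) (Suc n) M)"
    by (simp add: boxed_nth B_def)
  also have "\<dots> = (\<Sum>M\<in>over_msets N. of_bool (e \<in># M) * B (Suc L) (Suc n) M
      + of_bool (o' \<in># M) * (of_bool (e \<notin># M) * B (Suc L) (Suc n) M) + B L (Suc n) M)"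
    unfolding split[of "Suc n"] by (rule sum.cong[OF refl]) auto
  also have "\<dots> = (\<Sum>M\<in>over_msets N. of_bool (e \<in># M) * B (Suc L) (Suc n) M)
      + (\<Sum>M\<in>over_msets N. of_bool (o' \<in># M) * (of_bool (e \<notin># M) * B (Suc L) (Suc n) M))
      + boxed L (Suc n) $ N"
    by (simp add: sum.distrib boxed_nth B_def)
  also have "(\<Sum>M\<in>over_msets N. of_bool (e \<in># M) * B (Suc L) (Suc n) M) =
      (fps_X ^ Suc L * boxed (Suc L) n) $ N"
    unfolding sum_over_msets_mem[OF e(1)] e(2) fps_X_power_mult_nth
    using e(3) by (simp add: B_add_e boxed_nth B_def[symmetric] not_less)
  also have "(\<Sum>M\<in>over_msets N. of_bool (o' \<in># M) * (of_bool (e \<notin># M) * B (Suc L) (Suc n) M)) =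
      (fps_X ^ Suc L * boxed L n) $ N"
  proof -
    have "e \<noteq> o'" by (simp add: o'_def)
    then show ?thesis
      unfolding sum_over_msets_mem[OF o'(1)] o'(2) fps_X_power_mult_nth
      using o'(3) by (simp add: B_add_o boxed_nth B_def[symmetric] not_less split)
  qed
  finally show "boxed (Suc L) (Suc n) $ N =
      (boxed L (Suc n) + fps_X ^ Suc L * (boxed (Suc L) n + boxed L n)) $ N"
    by (simp add: distrib_left)
qed

text \<open>The conjugate of the row recurrence. It follows from the rows by induction on
  \<open>L + n\<close>, in place of an explicit conjugation of overpartitions.\<close>

lemma boxed_rec_column:
  "boxed (Suc L) (Suc n) = boxed (Suc L) n + fps_X ^ Suc n * (boxed L (Suc n) + boxed L n)"
proof (induction "L + n" arbitrary: L n rule: less_induct)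
  case less
  show ?case
  proof (cases L; cases n)
    assume "L = 0" "n = 0"
    then show ?thesis using boxed_rec_row[of 0 0] by (simp add: boxed_0_left boxed_0_right)
  next
    fix n' assume *: "L = 0" "n = Suc n'"
    show ?thesis
      using less[of 0 n'] boxed_rec_row[of 0 n'] boxed_rec_row[of 0 "Suc n'"]
      by (simp add: * boxed_0_left algebra_simps)
  next
    fix L' assume *: "L = Suc L'" "n = 0"
    define x :: "int fps" where "x = fps_X"
    define y where "y = x ^ Suc L'"
    have "boxed (Suc L) 1 = boxed L 1 + x * y * 2" "boxed L 1 = boxed L' 1 + y * 2"
      using boxed_rec_row[of "Suc L'" 0] boxed_rec_row[of L' 0]
      by (simp_all add: * boxed_0_right x_def y_def)
    moreover have "boxed L 1 = 1 + x * (boxed L' 1 + 1)"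
      using less[of L' 0] by (simp add: * boxed_0_right x_def)
    ultimately have "boxed (Suc L) 1 = 1 + x * (boxed L 1 + 1)" by algebra
    then show ?thesis by (simp add: * boxed_0_right x_def)
  next
    fix L' n' assume *: "L = Suc L'" "n = Suc n'"
    define x :: "int fps" where "x = fps_X"
    define p where "p = x ^ L"
    define s where "s = x ^ n"
    have diff_eq: "F - G = H" if "F = G + H" for F G H :: "int fps" using that by simp
    have row: "boxed (Suc L) (Suc n) = boxed L (Suc n) + x * p * (boxed (Suc L) n + boxed L n)"
      "boxed (Suc L) n = boxed L n + x * p * (boxed (Suc L) n' + boxed L n')"
      "boxed L (Suc n) = boxed L' (Suc n) + p * (boxed L n + boxed L' n)"
      "boxed L n = boxed L' n + p * (boxed L n' + boxed L' n')"
      using boxed_rec_row[of L n] boxed_rec_row[of L n'] boxed_rec_row[of L' n] boxed_rec_row[of L' n']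
      by (simp_all add: * x_def p_def)
    have col: "boxed L (Suc n) = boxed L n + x * s * (boxed L' (Suc n) + boxed L' n)"
      "boxed (Suc L) n = boxed (Suc L) n' + s * (boxed L n + boxed L n')"
      "boxed L n = boxed L n' + s * (boxed L' n + boxed L' n')"
      using less[of L' n] less[of L n'] less[of L' n'] by (simp_all add: * x_def s_def)
    \<comment> \<open>Subtracting two row recurrences leaves differences in the second argument;
      smaller column recurrences evaluate these, and the row recurrences for \<open>L\<close>
      reassemble the result.\<close>
    have "boxed (Suc L) (Suc n) - boxed (Suc L) n = (boxed L (Suc n) - boxed L n)
        + x * p * ((boxed (Suc L) n - boxed (Suc L) n') + (boxed L n - boxed L n'))"
      using arg_cong2[where f = "(-)", OF row(1,2)] by (rule trans) (simp only: algebra_simps)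
    also have "\<dots> = x * s * (boxed L' (Suc n) + boxed L' n)
        + x * p * (s * (boxed L n + boxed L n') + s * (boxed L' n + boxed L' n'))"
      unfolding diff_eq[OF col(1)] diff_eq[OF col(2)] diff_eq[OF col(3)] ..
    also have "\<dots> = x * s * ((boxed L' (Suc n) + p * (boxed L n + boxed L' n)) + (boxed L' n + p * (boxed L n' + boxed L' n')))"
      by (simp add: algebra_simps)
    also have "\<dots> = x * s * (boxed L (Suc n) + boxed L n)"
      using row(3,4) by simp
    finally show ?thesis by (simp add: x_def s_def diff_eq_eq add.commute)
  qed
qed

text \<open>Conjugation on the level of counts: exchanging the arguments turns the row recurrence
  into the column recurrence.\<close>

lemma boxed_commute: "boxed L n = boxed n L"
proof (induction "L + n" arbitrary: L n rule: less_induct)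
  case less
  show ?case
  proof (cases L; cases n)
    fix L' n' assume *: "L = Suc L'" "n = Suc n'"
    show ?thesis
      using less[of L' n] less[of L n'] less[of L' n'] boxed_rec_row[of L' n'] boxed_rec_column[of n' L']
      unfolding * by simp
  qed (simp_all add: boxed_0_left boxed_0_right)
qed

section \<open>Dyson's recurrence and the second rank moment\<close>

definition op_gf :: "int fps" where
  "op_gf = Abs_fps (\<lambda>N. int (card (over_msets N)))"

text \<open>The empty overpartition would pass the inequality only for \<open>m = 0\<close>; leaving
  it out makes Dyson's recurrence valid from \<open>m = 0\<close> on.\<close>

definition rank_ge :: "nat \<Rightarrow> int fps" where
  "rank_ge m = Abs_fps (\<lambda>N. \<Sum>M\<in>over_msets N. of_bool (M \<noteq> {#} \<and> size M + m \<le> largest M))"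

definition rank_le :: "nat \<Rightarrow> int fps" where
  "rank_le m = Abs_fps (\<lambda>N. \<Sum>M\<in>over_msets N. of_bool (largest M \<le> size M + m))"

lemma op_gf_nth: "op_gf $ N = (\<Sum>M\<in>over_msets N. 1)"
  by (simp add: op_gf_def)

lemma rank_ge_nth_small:
  assumes "N \<le> m" shows "rank_ge m $ N = 0"
proof -
  have "\<not> (M \<noteq> {#} \<and> size M + m \<le> largest M)" if "M \<in> over_msets N" for M
    using largest_le[OF that] assms by (cases "M = {#}") (auto simp: Suc_le_eq dest: nonempty_has_size[THEN iffD1])
  then show ?thesis unfolding rank_ge_def fps_nth_Abs_fps by (intro sum.neutral) auto
qed

text \<open>Sort by the largest part, written \<open>Suc m + j\<close>. The rank condition then
  bounds the number of parts by \<open>Suc j\<close>, and the row recurrence removes the largest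
  part.\<close>

lemma rank_ge_nth:
  "rank_ge m $ (N + Suc m) = (\<Sum>j\<le>N. (boxed (Suc m + j) j + boxed (m + j) j) $ (N - j))"
proof -
  let ?O = "over_msets (N + Suc m)"
  have pointwise: "(of_bool (M \<noteq> {#} \<and> size M + m \<le> largest M) :: int) =
      (\<Sum>j\<le>N. of_bool (largest M \<le> Suc m + j \<and> size M \<le> Suc j)
             - of_bool (largest M \<le> m + j \<and> size M \<le> Suc j))" if M: "M \<in> ?O" for M
  proof -
    have "(\<Sum>j\<le>N. of_bool (largest M \<le> Suc m + j \<and> size M \<le> Suc j)
             - of_bool (largest M \<le> m + j \<and> size M \<le> Suc j) :: int) =
          (\<Sum>j\<le>N. if j = largest M - Suc m then of_bool (Suc m \<le> largest M \<and> size M + m \<le> largest M) else 0)"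
      by (rule sum.cong[OF refl]) auto
    also have "\<dots> = of_bool (Suc m \<le> largest M \<and> size M + m \<le> largest M)"
    proof -
      have "largest M - Suc m \<le> N" using largest_le[OF M] by simp
      then show ?thesis by simp
    qed
    also have "(Suc m \<le> largest M \<and> size M + m \<le> largest M) \<longleftrightarrow> (M \<noteq> {#} \<and> size M + m \<le> largest M)"
      using nonempty_has_size[of M] by (auto simp: largest_def)
    finally show ?thesis by simp
  qed
  have "rank_ge m $ (N + Suc m) = (\<Sum>M\<in>?O. \<Sum>j\<le>N. of_bool (largest M \<le> Suc m + j \<and> size M \<le> Suc j)
             - of_bool (largest M \<le> m + j \<and> size M \<le> Suc j))"
    unfolding rank_ge_def fps_nth_Abs_fps by (rule sum.cong[OF refl]) (rule pointwise)
  also have "\<dots> = (\<Sum>j\<le>N. (boxed (Suc (m + j)) (Suc j) - boxed (m + j) (Suc j)) $ (N + Suc m))"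
    by (subst sum.swap) (simp add: boxed_nth sum_subtractf)
  also have "\<dots> = (\<Sum>j\<le>N. (boxed (Suc m + j) j + boxed (m + j) j) $ (N - j))"
  proof (rule sum.cong[OF refl])
    fix j assume "j \<in> {..N}"
    then have "\<not> N + Suc m < Suc (m + j)" "N + Suc m - Suc (m + j) = N - j" by auto
    moreover have "boxed (Suc (m + j)) (Suc j) - boxed (m + j) (Suc j)
        = fps_X ^ Suc (m + j) * (boxed (Suc (m + j)) j + boxed (m + j) j)"
      using boxed_rec_row[of "m + j" j] by simp
    ultimately show "(boxed (Suc (m + j)) (Suc j) - boxed (m + j) (Suc j)) $ (N + Suc m) =
        (boxed (Suc m + j) j + boxed (m + j) j) $ (N - j)"
      by (simp only: fps_X_power_mult_nth if_False add_Suc)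
  qed
  finally show ?thesis .
qed

text \<open>Sort by the number of parts, written \<open>Suc j\<close>. The rank condition then
  bounds the largest part, and the column recurrence removes the first column.\<close>

lemma rank_le_nth:
  "rank_le (Suc m) $ N = (\<Sum>j\<le>N. boxed (m + j) j $ (N - j)) + (\<Sum>j<N. boxed (Suc m + j) j $ (N - Suc j))"
proof -
  let ?O = "over_msets N"
  have pointwise: "(of_bool (largest M \<le> size M + Suc m) :: int) = of_bool (M = {#}) +
      (\<Sum>j<N. of_bool (largest M \<le> Suc (Suc m + j) \<and> size M \<le> Suc j)
             - of_bool (largest M \<le> Suc (Suc m + j) \<and> size M \<le> j))" if M: "M \<in> ?O" for M
  proof -
    have "(\<Sum>j<N. of_bool (largest M \<le> Suc (Suc m + j) \<and> size M \<le> Suc j)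
             - of_bool (largest M \<le> Suc (Suc m + j) \<and> size M \<le> j) :: int) =
          (\<Sum>j<N. if j = size M - 1 then of_bool (M \<noteq> {#} \<and> largest M \<le> size M + Suc m) else 0)"
      using nonempty_has_size[of M] by (intro sum.cong[OF refl]) (auto simp: largest_def)
    also have "\<dots> = of_bool (M \<noteq> {#} \<and> largest M \<le> size M + Suc m)"
      using size_le[OF M] nonempty_has_size[of M] by auto
    finally show ?thesis by (auto simp: largest_def)
  qed
  have "rank_le (Suc m) $ N = (\<Sum>M\<in>?O. of_bool (M = {#}) +
      (\<Sum>j<N. of_bool (largest M \<le> Suc (Suc m + j) \<and> size M \<le> Suc j)
             - of_bool (largest M \<le> Suc (Suc m + j) \<and> size M \<le> j)))"
    unfolding rank_le_def fps_nth_Abs_fps by (rule sum.cong[OF refl]) (rule pointwise)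
  also have "\<dots> = of_bool (N = 0) +
      (\<Sum>j<N. (boxed (Suc (Suc m + j)) (Suc j) - boxed (Suc (Suc m + j)) j) $ N)"
    unfolding sum.distrib sum_empty by (subst sum.swap) (simp add: boxed_nth sum_subtractf)
  also have "(\<Sum>j<N. (boxed (Suc (Suc m + j)) (Suc j) - boxed (Suc (Suc m + j)) j) $ N) =
      (\<Sum>j<N. boxed (m + Suc j) (Suc j) $ (N - Suc j) + boxed (Suc m + j) j $ (N - Suc j))"
  proof (rule sum.cong[OF refl])
    fix j assume "j \<in> {..<N}"
    then have "\<not> N < Suc j" by auto
    moreover have "boxed (Suc (Suc m + j)) (Suc j) - boxed (Suc (Suc m + j)) j
        = fps_X ^ Suc j * (boxed (Suc m + j) (Suc j) + boxed (Suc m + j) j)"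
      using boxed_rec_column[of "Suc m + j" j] by simp
    ultimately show "(boxed (Suc (Suc m + j)) (Suc j) - boxed (Suc (Suc m + j)) j) $ N =
        boxed (m + Suc j) (Suc j) $ (N - Suc j) + boxed (Suc m + j) j $ (N - Suc j)"
      by (simp only: fps_X_power_mult_nth if_False fps_add_nth add_Suc add_Suc_right)
  qed
  \<comment> \<open>The empty overpartition supplies the term \<open>j = 0\<close> of the first sum,
    whose index is shifted by one.\<close>
  also have "of_bool (N = 0) + \<dots> = (\<Sum>j\<le>N. boxed (m + j) j $ (N - j)) + (\<Sum>j<N. boxed (Suc m + j) j $ (N - Suc j))"
    by (simp add: sum.distrib sum.lessThan_Suc_shift[of _ N, folded lessThan_Suc_atMost] lessThan_Suc_atMost[symmetric]
        boxed_0_right del: sum.lessThan_Suc)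
  finally show ?thesis .
qed

lemma rank_ge_plus_rank_le: "rank_ge (Suc m) + rank_le m = op_gf"
proof (rule fps_ext)
  fix N
  have "of_bool (M \<noteq> {#} \<and> size M + Suc m \<le> largest M) + of_bool (largest M \<le> size M + m) = (1::int)" for M
    by (auto simp: largest_def)
  then show "(rank_ge (Suc m) + rank_le m) $ N = op_gf $ N"
    by (simp only: fps_add_nth rank_ge_def rank_le_def fps_nth_Abs_fps sum.distrib[symmetric] op_gf_nth)
qed

text \<open>The generating function form of Dyson's bijection: remove the largest part on the left-hand
  side, and the first column of the Ferrers diagram on the right-hand side.\<close>

lemma rank_ge_Dyson:
  "rank_ge m + rank_ge (Suc m) = fps_X ^ Suc m * (rank_le (Suc (Suc m)) + rank_le (Suc m))"
proof (rule fps_ext)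
  fix N
  show "(rank_ge m + rank_ge (Suc m)) $ N = (fps_X ^ Suc m * (rank_le (Suc (Suc m)) + rank_le (Suc m))) $ N"
  proof (cases "N \<le> m")
    case True
    then show ?thesis by (simp add: rank_ge_nth_small fps_X_power_mult_nth del: power_Suc)
  next
    case False
    then obtain K where N: "N = K + Suc m" by (metis Suc_leI add.commute le_Suc_ex not_le)
    have "rank_ge (Suc m) $ (K + Suc m) =
      (\<Sum>j<K. (boxed (Suc (Suc m) + j) j + boxed (Suc m + j) j) $ (K - Suc j))"
    proof (cases K)
      case (Suc K')
      then show ?thesis using rank_ge_nth[of "Suc m" K'] by (simp add: lessThan_Suc_atMost)
    qed (simp add: rank_ge_nth_small)
    then show ?thesis
      unfolding N fps_add_nth rank_ge_nth fps_X_power_mult_nth rank_le_nth by (simp add: sum.distrib)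
  qed
qed

section \<open>Solving Dyson's recurrence by partial theta series\<close>

text \<open>The partial theta series with terms (-1)^(n+1) q^(n(n+m)) for n >= 1. A term of exponent
  \<open>N\<close> has \<open>n\<close> at most \<open>N\<close>, which keeps the range
  finite.\<close>

definition signed_theta :: "nat \<Rightarrow> int fps" where
  "signed_theta m = Abs_fps (\<lambda>N. \<Sum>n=1..N. of_bool (n * (n + m) = N) * (-1) ^ Suc n)"

text \<open>The term \<open>n = 1\<close> splits off; for the others (n+1)(n+1+m) = n(n+m+2) +
  (m+1), with the opposite sign.\<close>

lemma signed_theta_rec: "signed_theta m = fps_X ^ Suc m * (1 - signed_theta (m + 2))"
proof (rule fps_ext)
  fix N
  show "signed_theta m $ N = (fps_X ^ Suc m * (1 - signed_theta (m + 2))) $ N"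
  proof (cases "N \<le> m")
    case True
    have "n * (n + m) \<noteq> N" if "n \<in> {1..N}" for n
    proof -
      have "1 * (n + m) \<le> n * (n + m)" using that by (intro mult_le_mono1) simp
      then show ?thesis using that True by (simp only: atLeastAtMost_iff mult_1) linarith
    qed
    then have "signed_theta m $ N = 0"
      unfolding signed_theta_def fps_nth_Abs_fps by (intro sum.neutral) simp
    then show ?thesis using True by (simp add: fps_X_power_mult_nth del: power_Suc)
  next
    case False
    then obtain K where N: "N = K + Suc m" by (metis Suc_leI add.commute le_Suc_ex not_le)
    have "signed_theta m $ N = (\<Sum>n<K + Suc m. of_bool (Suc n * (Suc n + m) = K + Suc m) * (-1) ^ n)"
      unfolding signed_theta_def fps_nth_Abs_fps N
      by (simp only: One_nat_def sum.atLeast1_atMost_eq power_Suc mult_minus1 minus_minus)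
    also have "\<dots> = (\<Sum>n<K + Suc m. of_bool (n * (n + (m + 2)) = K) * (-1) ^ n)"
    proof (rule sum.cong[OF refl])
      fix n
      have "Suc n * (Suc n + m) = n * (n + (m + 2)) + Suc m" by (simp add: algebra_simps)
      then show "of_bool (Suc n * (Suc n + m) = K + Suc m) * (-1) ^ n =
          (of_bool (n * (n + (m + 2)) = K) * (-1) ^ n :: int)" by simp
    qed
    also have "\<dots> = (\<Sum>n\<le>K. of_bool (n * (n + (m + 2)) = K) * (-1) ^ n)"
    proof (rule sum.mono_neutral_right)
      show "\<forall>n\<in>{..<K + Suc m} - {..K}. of_bool (n * (n + (m + 2)) = K) * (-1) ^ n = (0::int)"
      proof
        fix n assume "n \<in> {..<K + Suc m} - {..K}"
        then have "K < n" by auto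
        moreover have "n * 1 \<le> n * (n + (m + 2))" by (intro mult_le_mono2) simp
        ultimately show "of_bool (n * (n + (m + 2)) = K) * (-1) ^ n = (0::int)" by simp
      qed
    qed auto
    also have "\<dots> = of_bool (K = 0) - signed_theta (m + 2) $ K"
    proof -
      have "{..K} = insert 0 {1..K}" by auto
      then show ?thesis by (simp add: signed_theta_def sum_negf)
    qed
    finally show ?thesis unfolding N by (simp add: fps_X_power_mult_nth del: power_Suc)
  qed
qed

text \<open>By Dyson's recurrence and complementation both sides solve the same recurrence from
  \<open>m + 2\<close> to \<open>m\<close>. Their difference solves the homogeneous one, whose
  positive power of \<open>fps_X\<close> forces every coefficient to vanish.\<close>

lemma rank_ge_pair: "rank_ge m + rank_ge (Suc m) = 2 * op_gf * signed_theta m"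
proof (rule fps_ext)
  fix N
  define D where "D m = rank_ge m + rank_ge (Suc m) - 2 * op_gf * signed_theta m" for m
  have rec: "D m = - (fps_X ^ Suc m * D (m + 2))" for m
  proof -
    have "rank_ge m + rank_ge (Suc m) = fps_X ^ Suc m * (2 * op_gf - (rank_ge (m + 2) + rank_ge (Suc (m + 2))))"
    proof -
      have "rank_le (Suc m) = op_gf - rank_ge (m + 2)" "rank_le (Suc (Suc m)) = op_gf - rank_ge (Suc (m + 2))"
        using rank_ge_plus_rank_le[of "Suc m"] rank_ge_plus_rank_le[of "Suc (Suc m)"]
        by (simp_all add: eq_diff_eq add.commute)
      then have "rank_le (Suc (Suc m)) + rank_le (Suc m) = 2 * op_gf - (rank_ge (m + 2) + rank_ge (Suc (m + 2)))"
        by (simp only: mult_2) (simp only: algebra_simps)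
      then show ?thesis by (simp only: rank_ge_Dyson[of m])
    qed
    moreover have "2 * op_gf * signed_theta m = fps_X ^ Suc m * (2 * op_gf - 2 * op_gf * signed_theta (m + 2))"
      by (subst signed_theta_rec) (simp add: algebra_simps del: power_Suc)
    ultimately show ?thesis
      unfolding D_def by (simp add: right_diff_distrib del: power_Suc)
  qed
  have "D m $ N = 0" for m
  proof (induction N arbitrary: m rule: less_induct)
    case (less N)
    show ?case
      by (subst rec) (simp add: fps_X_power_mult_nth less.IH del: power_Suc)
  qed
  then have "D m $ N = 0" .
  then show "(rank_ge m + rank_ge (Suc m)) $ N = (2 * op_gf * signed_theta m) $ N"
    by (simp add: D_def)
qed

text \<open>The joint distribution of largest part and number of parts is a second difference of box
  counts, so it inherits the symmetry of \<open>boxed\<close>.\<close>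

lemma sum_largest_size_commute:
  fixes H :: "nat \<Rightarrow> nat \<Rightarrow> int"
  shows "(\<Sum>M\<in>over_msets N. H (largest M) (size M)) = (\<Sum>M\<in>over_msets N. H (size M) (largest M))"
proof -
  \<comment> \<open>Strict inequalities make \<open>st\<close> vanish when an argument is 0, so one
    formula for the second difference covers the value 0 as well.\<close>
  define st where "st L n = (\<Sum>M\<in>over_msets N. of_bool (largest M < L \<and> size M < n) :: int)" for L n
  have st: "st L n = st n L" for L n
  proof (cases L; cases n)
    fix L' n' assume "L = Suc L'" "n = Suc n'"
    then show ?thesis unfolding st_def
      by (simp only: less_Suc_eq_le boxed_nth[symmetric]) (rule arg_cong[OF boxed_commute])
  qed (simp_all add: st_def)
  define u where "u k n = (\<Sum>M\<in>over_msets N. of_bool (largest M = k \<and> size M = n) :: int)" for k n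
  have "u k n = st (Suc k) (Suc n) - st k (Suc n) - st (Suc k) n + st k n" for k n
    unfolding u_def st_def sum_subtractf[symmetric] sum.distrib[symmetric]
    by (rule sum.cong[OF refl]) auto
  then have u: "u k n = u n k" for k n using st by simp
  have expand: "(\<Sum>M\<in>over_msets N. H' (largest M) (size M)) = (\<Sum>k\<le>N. \<Sum>n\<le>N. u k n * H' k n)"
    for H' :: "nat \<Rightarrow> nat \<Rightarrow> int"
  proof -
    have "(\<Sum>M\<in>over_msets N. H' (largest M) (size M)) =
        (\<Sum>M\<in>over_msets N. \<Sum>k\<le>N. \<Sum>n\<le>N. of_bool (largest M = k \<and> size M = n) * H' k n)"
    proof (rule sum.cong[OF refl])
      fix M assume M: "M \<in> over_msets N"
      have "(\<Sum>k\<le>N. \<Sum>n\<le>N. of_bool (largest M = k \<and> size M = n) * H' k n) =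
          (\<Sum>k\<le>N. if k = largest M then (\<Sum>n\<le>N. if n = size M then H' k n else 0) else 0)"
        by (intro sum.cong[OF refl]) (auto intro!: sum.cong)
      then show "H' (largest M) (size M) =
          (\<Sum>k\<le>N. \<Sum>n\<le>N. of_bool (largest M = k \<and> size M = n) * H' k n)"
        using largest_le[OF M] size_le[OF M] by simp
    qed
    also have "\<dots> = (\<Sum>k\<le>N. \<Sum>n\<le>N. u k n * H' k n)"
      unfolding u_def sum_distrib_right
      by (subst sum.swap, rule sum.cong[OF refl], rule sum.swap)
    finally show ?thesis .
  qed
  have "(\<Sum>M\<in>over_msets N. H (largest M) (size M)) = (\<Sum>k\<le>N. \<Sum>n\<le>N. u k n * H k n)"
    by (rule expand)
  also have "\<dots> = (\<Sum>k\<le>N. \<Sum>n\<le>N. u k n * H n k)"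
    by (subst sum.swap) (simp add: u)
  also have "\<dots> = (\<Sum>M\<in>over_msets N. H (size M) (largest M))"
    by (rule expand[symmetric])
  finally show ?thesis .
qed

text \<open>A non-empty overpartition has either nonnegative or negative rank, and by conjugation
  negative ranks are as frequent as positive ones. Hence \<open>rank_ge_pair\<close> at 0 determines
  \<open>op_gf\<close>.\<close>

lemma op_gf_theta: "op_gf * (1 - 2 * signed_theta 0) = 1"
proof -
  have "rank_ge 0 + rank_ge (Suc 0) = op_gf - 1"
  proof (rule fps_ext)
    fix N
    have "rank_ge (Suc 0) $ N = (\<Sum>M\<in>over_msets N. of_bool (size M < largest M))"
      unfolding rank_ge_def fps_nth_Abs_fps by (rule sum.cong[OF refl]) (auto simp: largest_def)
    also have "\<dots> = (\<Sum>M\<in>over_msets N. of_bool (largest M < size M))"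
      by (rule sum_largest_size_commute[of "\<lambda>l s. of_bool (s < l)"])
    finally have "(rank_ge 0 + rank_ge (Suc 0)) $ N =
        (\<Sum>M\<in>over_msets N. of_bool (M \<noteq> {#} \<and> size M \<le> largest M) + of_bool (largest M < size M))"
      by (simp add: rank_ge_def sum.distrib)
    also have "\<dots> = (\<Sum>M\<in>over_msets N. 1 - of_bool (M = {#}))"
      by (rule sum.cong[OF refl]) auto
    also have "\<dots> = (op_gf - 1) $ N" by (simp add: sum_subtractf sum_empty op_gf_nth)
    finally show "(rank_ge 0 + rank_ge (Suc 0)) $ N = (op_gf - 1) $ N" .
  qed
  then show ?thesis using rank_ge_pair[of 0] by (simp add: algebra_simps)
qed

section \<open>The second rank moment as a sum over factorisations\<close>

definition factor_pairs :: "nat \<Rightarrow> (nat \<times> nat) set" where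
  "factor_pairs i = {(d, e). 0 < d \<and> 0 < e \<and> d * e = i}"

lemma factor_pairs_subset: "factor_pairs i \<subseteq> {1..i} \<times> {1..i}"
  by (auto simp: factor_pairs_def Suc_le_eq)

lemma finite_factor_pairs: "finite (factor_pairs i)"
  using factor_pairs_subset finite_subset by blast

text \<open>A square is the sum of two consecutive triangular numbers; the weights are matched to
  the pairs \<open>rank_ge m + rank_ge (Suc m)\<close>.\<close>

lemma sum_triangle: 
  assumes "r \<le> N"
  shows "(\<Sum>m=1..N. int m * (of_bool (m \<le> r) + of_bool (Suc m \<le> r))) = int r ^ 2"
proof -
  have "(\<Sum>m=1..N. int m * (of_bool (m \<le> r) + of_bool (Suc m \<le> r))) =
      (\<Sum>m=1..r. int m * (of_bool (m \<le> r) + of_bool (Suc m \<le> r)))"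
    using assms by (intro sum.mono_neutral_right) auto
  also have "\<dots> = int r ^ 2"
  proof (induction r)
    case (Suc r)
    have "(\<Sum>m=1..Suc r. int m * (of_bool (m \<le> Suc r) + of_bool (Suc m \<le> Suc r))) =
        (\<Sum>m=1..r. int m * (of_bool (m \<le> Suc r) + of_bool (m \<le> r))) + int (Suc r)"
      by simp
    also have "(\<Sum>m=1..r. int m * (of_bool (m \<le> Suc r) + of_bool (m \<le> r))) =
        (\<Sum>m=1..r. int m * (of_bool (m \<le> r) + of_bool (Suc m \<le> r)) + int m * of_bool (m = r))"
      by (rule sum.cong[OF refl]) auto
    also have "\<dots> = int r ^ 2 + int r"
      using Suc.IH by (cases r) (simp_all add: sum.distrib)
    finally show ?case by (simp add: power2_eq_square algebra_simps)
  qed simp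
  finally show ?thesis .
qed

text \<open>Averaging with the conjugate gives n(l-n) + l(n-l) = -(l-n)^2, so the sum is minus half
  the second rank moment. Positive and negative ranks contribute equally to that moment.\<close>

lemma sum_size_rank:
  "(\<Sum>M\<in>over_msets N. int (size M) * (int (largest M) - int (size M))) =
     - (\<Sum>m=1..N. int m * (rank_ge m + rank_ge (Suc m)) $ N)"
proof -
  define A where "A = (\<Sum>M\<in>over_msets N. int (size M) * (int (largest M) - int (size M)))"
  \<comment> \<open>The subtraction of natural numbers truncates, so only positive ranks
    contribute.\<close>
  define Q where "Q = (\<Sum>M\<in>over_msets N. int (largest M - size M) ^ 2)"
  have "A = (\<Sum>M\<in>over_msets N. int (largest M) * (int (size M) - int (largest M)))"
    unfolding A_def
    by (rule sum_largest_size_commute[of "\<lambda>l s. int s * (int l - int s)"])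
  then have "2 * A = (\<Sum>M\<in>over_msets N. int (size M) * (int (largest M) - int (size M))
      + int (largest M) * (int (size M) - int (largest M)))"
    unfolding sum.distrib A_def by simp
  also have "\<dots> = - (\<Sum>M\<in>over_msets N. int (largest M - size M) ^ 2 + int (size M - largest M) ^ 2)"
    unfolding sum_negf[symmetric]
  proof (rule sum.cong[OF refl])
    fix M
    show "int (size M) * (int (largest M) - int (size M)) + int (largest M) * (int (size M) - int (largest M)) =
      - (int (largest M - size M) ^ 2 + int (size M - largest M) ^ 2)"
      by (cases "size M \<le> largest M") (simp_all add: of_nat_diff power2_eq_square algebra_simps)
  qed
  also have "\<dots> = - (Q + Q)"
    using sum_largest_size_commute[of "\<lambda>l s. int (l - s) ^ 2" N] by (simp add: sum.distrib Q_def)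
  finally have "A = - Q" by simp
  moreover have "Q = (\<Sum>m=1..N. int m * (rank_ge m + rank_ge (Suc m)) $ N)"
  proof -
    have "Q = (\<Sum>M\<in>over_msets N. \<Sum>m=1..N. int m * (of_bool (M \<noteq> {#} \<and> size M + m \<le> largest M)
        + of_bool (M \<noteq> {#} \<and> size M + Suc m \<le> largest M)))"
      unfolding Q_def
    proof (rule sum.cong[OF refl])
      fix M assume "M \<in> over_msets N"
      then have "largest M - size M \<le> N" using largest_le diff_le_self order_trans by blast
      then have "int (largest M - size M) ^ 2 =
          (\<Sum>m=1..N. int m * (of_bool (m \<le> largest M - size M) + of_bool (Suc m \<le> largest M - size M)))"
        by (rule sum_triangle[symmetric])
      also have "\<dots> = (\<Sum>m=1..N. int m * (of_bool (M \<noteq> {#} \<and> size M + m \<le> largest M)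
        + of_bool (M \<noteq> {#} \<and> size M + Suc m \<le> largest M)))"
      proof (rule sum.cong[OF refl])
        fix m assume "m \<in> {1..N}"
        then have "j \<le> largest M - size M \<longleftrightarrow> M \<noteq> {#} \<and> size M + j \<le> largest M" if "m \<le> j" for j
          using that by (auto simp: largest_def)
        from this[of m] this[of "Suc m"]
        show "int m * (of_bool (m \<le> largest M - size M) + of_bool (Suc m \<le> largest M - size M)) =
          int m * (of_bool (M \<noteq> {#} \<and> size M + m \<le> largest M)
          + of_bool (M \<noteq> {#} \<and> size M + Suc m \<le> largest M))" by simp
      qed
      finally show "int (largest M - size M) ^ 2 = \<dots>" .
    qed
    then show ?thesis
      by (subst (asm) sum.swap) (simp add: rank_ge_def sum.distrib sum_distrib_left distrib_left)
  qed
  ultimately show ?thesis by (simp add: A_def)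
qed

definition gap_series :: "int fps" where
  "gap_series = Abs_fps (\<lambda>i. \<Sum>(d, e)\<in>factor_pairs i. of_bool (d < e) * ((-1) ^ d * (int e - int d)))"

text \<open>Substitute \<open>d = n\<close> and \<open>e = n + m\<close>. Since \<open>e\<close>
  divides \<open>i\<close> and \<open>i\<close> is at most \<open>N\<close>, the bound on
  \<open>m\<close> cuts nothing off.\<close>

lemma sum_signed_theta:
  assumes "i \<le> N"
  shows "(\<Sum>m=1..N. int m * signed_theta m $ i) = - gap_series $ i"
proof -
  have "(\<Sum>m=1..N. int m * signed_theta m $ i) =
      (\<Sum>(m, n)\<in>{1..N} \<times> {1..i}. of_bool (n * (n + m) = i) * (int m * (-1) ^ Suc n))"
    by (simp add: signed_theta_def sum_distrib_left sum.cartesian_product mult.left_commute)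
  also have "\<dots> = (\<Sum>(m, n)\<in>{(m, n) \<in> {1..N} \<times> {1..i}. n * (n + m) = i}. int m * (-1) ^ Suc n)"
    by (rule sum.mono_neutral_cong_right) auto
  also have "\<dots> = (\<Sum>(d, e)\<in>{(d, e) \<in> factor_pairs i. d < e}. - ((-1) ^ d * (int e - int d)))"
  proof (rule sum.reindex_bij_witness[of _ "\<lambda>(d, e). (e - d, d)" "\<lambda>(m, n). (n, n + m)"])
    fix p assume p: "p \<in> {(d, e) \<in> factor_pairs i. d < e}"
    then obtain d e where de: "p = (d, e)" "d < e" "(d, e) \<in> factor_pairs i" by auto
    then have "d * e = i" "d \<in> {1..i}" "e \<in> {1..i}"
      using factor_pairs_subset by (auto simp: factor_pairs_def)
    moreover from this have "e - d \<le> N" using assms by (simp, linarith)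
    ultimately show "(case p of (d, e) \<Rightarrow> (e - d, d)) \<in> {(m, n) \<in> {1..N} \<times> {1..i}. n * (n + m) = i}"
      using de assms by auto
  qed (auto simp: factor_pairs_def)
  also have "\<dots> = (\<Sum>(d, e)\<in>factor_pairs i. - (of_bool (d < e) * ((-1) ^ d * (int e - int d))))"
    by (rule sum.mono_neutral_cong_left) (auto simp: finite_factor_pairs)
  also have "\<dots> = - gap_series $ i"
    by (simp add: gap_series_def sum_negf case_prod_unfold)
  finally show ?thesis .
qed

lemma double_op_gf_mult_nth: "(2 * op_gf * F) $ N = 2 * (\<Sum>i=0..N. op_gf $ (N - i) * F $ i)"
proof -
  have "2 * op_gf * F = F * op_gf + F * op_gf" by (simp add: mult_2 algebra_simps)
  then show ?thesis by (simp only: fps_add_nth fps_mult_nth mult_2 mult.commute)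
qed

lemma sum_size_rank_gf:
  "(\<Sum>M\<in>over_msets N. int (size M) * (int (largest M) - int (size M))) = (2 * op_gf * gap_series) $ N"
proof -
  have "(\<Sum>m=1..N. int m * (rank_ge m + rank_ge (Suc m)) $ N) =
     2 * (\<Sum>m=1..N. int m * (\<Sum>i=0..N. op_gf $ (N - i) * signed_theta m $ i))"
    unfolding rank_ge_pair double_op_gf_mult_nth
    by (subst sum_distrib_left) (rule sum.cong[OF refl], rule mult.left_commute)
  also have "(\<Sum>m=1..N. int m * (\<Sum>i=0..N. op_gf $ (N - i) * signed_theta m $ i)) =
     (\<Sum>i=0..N. op_gf $ (N - i) * (\<Sum>m=1..N. int m * signed_theta m $ i))"
    unfolding sum_distrib_left by (subst sum.swap) (simp only: mult.left_commute)
  also have "\<dots> = (\<Sum>i=0..N. op_gf $ (N - i) * - gap_series $ i)"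
    by (rule sum.cong[OF refl]) (simp add: sum_signed_theta del: One_nat_def)
  finally show ?thesis
    unfolding sum_size_rank double_op_gf_mult_nth by (simp add: sum_negf)
qed

section \<open>Odd non-overlined parts\<close>

text \<open>Removing copies of one part turns a multiplicity into a sum over overpartitions of smaller
  numbers; a non-overlined part can be removed as often as it occurs.\<close>

definition shifted_size_sum :: "nat \<Rightarrow> nat \<Rightarrow> int" where
  "shifted_size_sum j N = (\<Sum>M\<in>over_msets N. int (size M + j))"

text \<open>The recurrence is unrolled: each round removes one part of size \<open>k\<close>, raises
  the shift \<open>j\<close> by one and contributes a factor \<open>s\<close>, which will be 1 or
  -1.\<close>

lemma sum_multiplicity_step:
  fixes F :: "nat \<Rightarrow> nat \<Rightarrow> int"
  assumes k: "0 < k"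
    and step: "\<And>j N. F j N = (if k \<le> N then s * F (Suc j) (N - k) + t * shifted_size_sum (Suc j) (N - k) else 0)"
  shows "F j N = (\<Sum>i=1..N. of_bool (i * k \<le> N) * (t * s ^ (i - 1) * shifted_size_sum (i + j) (N - i * k)))"
proof (induction N arbitrary: j rule: less_induct)
  case (less N)
  let ?G = "\<lambda>N j i. of_bool (i * k \<le> N) * (t * s ^ (i - 1) * shifted_size_sum (i + j) (N - i * k))"
  show ?case
  proof (cases "k \<le> N")
    case True
    then obtain K where N: "N = K + k" by (metis add.commute le_iff_add)
    have "K < N" using k N by simp
    \<comment> \<open>Terms with \<open>i > K\<close> vanish because \<open>k\<close> is positive,
      so the upper bound may be raised to \<open>N - 1\<close>.\<close>
    have ext: "(\<Sum>i=1..K. ?G K (Suc j) i) = (\<Sum>i=1..K + k - 1. ?G K (Suc j) i)"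
    proof (rule sum.mono_neutral_left)
      show "\<forall>i\<in>{1..K + k - 1} - {1..K}. ?G K (Suc j) i = 0"
      proof
        fix i assume "i \<in> {1..K + k - 1} - {1..K}"
        then have "K < i" by auto
        moreover have "i * 1 \<le> i * k" using k by (intro mult_le_mono2) simp
        ultimately have "\<not> i * k \<le> K" by linarith
        then show "?G K (Suc j) i = 0" by simp
      qed
    qed (use k in auto)
    have "(\<Sum>i=1..N. ?G N j i) = ?G N j 1 + (\<Sum>i=1..K + k - 1. ?G N j (Suc i))"
    proof -
      have "sum g {1..n} = g 1 + (\<Sum>i=1..n - 1. g (Suc i))" if "0 < n" for g :: "nat \<Rightarrow> int" and n
        using that by (cases n) (simp_all only: sum.atLeast_Suc_atMost[of 1 "Suc _" g] sum.shift_bounds_cl_Suc_ivl, simp_all)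
      moreover have "0 < N" using N k by simp
      ultimately show ?thesis by (simp only: N)
    qed
    also have "?G N j 1 = t * shifted_size_sum (Suc j) K" using N by simp
    also have "(\<Sum>i=1..K + k - 1. ?G N j (Suc i)) = s * (\<Sum>i=1..K + k - 1. ?G K (Suc j) i)"
      unfolding sum_distrib_left
    proof (rule sum.cong[OF refl])
      fix i assume "i \<in> {1..K + k - 1}"
      then obtain i' where "i = Suc i'" by (cases i) auto
      then show "?G N j (Suc i) = s * ?G K (Suc j) i" unfolding N by simp
    qed
    also have "t * shifted_size_sum (Suc j) K + s * (\<Sum>i=1..K + k - 1. ?G K (Suc j) i) = F j N"
      unfolding ext[symmetric] less.IH[OF \<open>K < N\<close>, symmetric]
      by (subst step) (simp add: N)
    finally show ?thesis by simp
  next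
    case False
    have "?G N j i = 0" if "i \<in> {1..N}" for i
    proof -
      have "1 * k \<le> i * k" using that by (intro mult_le_mono1) simp
      then have "\<not> i * k \<le> N" using False by linarith
      then show ?thesis by simp
    qed
    then have "(\<Sum>i=1..N. ?G N j i) = 0" by (intro sum.neutral) blast
    then show ?thesis using False by (subst step) simp
  qed
qed

text \<open>Removing one copy lowers the multiplicity by one, which reproduces the sum for
  \<open>N - k\<close> and leaves a plain sum of shifted sizes.\<close>

lemma sum_nonoverlined_multiplicity:
  assumes "0 < k"
  shows "(\<Sum>M\<in>over_msets N. int (count M (2 * k)) * int (size M + j)) =
    (\<Sum>i=1..N. of_bool (i * k \<le> N) * shifted_size_sum (i + j) (N - i * k))"
proof -
  have e: "2 \<le> 2 * k" "2 * k div 2 = k" "\<not> odd (2 * k)" using assms by auto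
  have "(\<Sum>M\<in>over_msets N. int (count M (2 * k)) * int (size M + j)) =
      (if k \<le> N then 1 * (\<Sum>M\<in>over_msets (N - k). int (count M (2 * k)) * int (size M + Suc j))
         + 1 * shifted_size_sum (Suc j) (N - k) else 0)" for N j
  proof -
    have "(\<Sum>M\<in>over_msets N. int (count M (2 * k)) * int (size M + j)) =
        (\<Sum>M\<in>over_msets N. of_bool (2 * k \<in># M) * (int (count M (2 * k)) * int (size M + j)))"
      by (rule sum.cong[OF refl]) (auto simp: not_in_iff)
    also have "\<dots> = (if k \<le> N then \<Sum>M\<in>over_msets (N - k). int (Suc (count M (2 * k))) * int (size M + Suc j) else 0)"
      unfolding sum_over_msets_mem[OF e(1)] e(2) using e(3) by simp
    finally show ?thesis by (simp add: shifted_size_sum_def sum.distrib algebra_simps)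
  qed
  from sum_multiplicity_step[OF assms this, where j = j and N = N] show ?thesis by simp
qed

text \<open>After the overlined part is removed it must be absent. Writing absence as total minus
  presence yields the recurrence with sign -1.\<close>

lemma sum_overlined_multiplicity:
  assumes "0 < k"
  shows "(\<Sum>M\<in>over_msets N. int (count M (Suc (2 * k))) * int (size M + j)) =
    (\<Sum>i=1..N. of_bool (i * k \<le> N) * ((-1) ^ (i - 1) * shifted_size_sum (i + j) (N - i * k)))"
proof -
  let ?o = "Suc (2 * k)"
  have o: "2 \<le> ?o" "?o div 2 = k" "odd ?o" using assms by auto
  have cnt: "int (count M ?o) = of_bool (?o \<in># M)" if "M \<in> over_msets N" for M N
  proof -
    have "count M ?o \<le> 1" using that o(3) by (auto simp: over_msets_def)
    moreover have "c = of_bool (0 < c)" if "c \<le> 1" for c :: nat using that by (cases c) auto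
    ultimately have "count M ?o = of_bool (0 < count M ?o)" by blast
    then have "count M ?o = of_bool (?o \<in># M)" by (simp only: count_greater_zero_iff)
    then show ?thesis by simp
  qed
  have "(\<Sum>M\<in>over_msets N. int (count M ?o) * int (size M + j)) =
      (if k \<le> N then (-1) * (\<Sum>M\<in>over_msets (N - k). int (count M ?o) * int (size M + Suc j))
         + 1 * shifted_size_sum (Suc j) (N - k) else 0)" for N j
  proof -
    have "(\<Sum>M\<in>over_msets N. int (count M ?o) * int (size M + j)) =
        (\<Sum>M\<in>over_msets N. of_bool (?o \<in># M) * int (size M + j))"
      by (rule sum.cong[OF refl]) (simp add: cnt)
    also have "\<dots> = (if k \<le> N then \<Sum>M\<in>over_msets (N - k). of_bool (?o \<notin># M) * int (size M + Suc j) else 0)"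
      unfolding sum_over_msets_mem[OF o(1)] o(2) using o(3) by simp
    also have "(\<Sum>M\<in>over_msets (N - k). of_bool (?o \<notin># M) * int (size M + Suc j)) =
       (\<Sum>M\<in>over_msets (N - k). int (size M + Suc j) - int (count M ?o) * int (size M + Suc j))"
      by (rule sum.cong[OF refl]) (simp add: cnt)
    finally show ?thesis by (simp add: shifted_size_sum_def sum_subtractf)
  qed
  from sum_multiplicity_step[OF assms this, where j = j and N = N] show ?thesis by simp
qed

lemma size_eq_sum_count:
  assumes "M \<in> over_msets N"
  shows "int (size M) = (\<Sum>k=1..N. int (count M (2 * k)) + int (count M (Suc (2 * k))))"
proof -
  have sub: "set_mset M \<subseteq> (\<lambda>k. 2 * k) ` {1..N} \<union> (\<lambda>k. Suc (2 * k)) ` {1..N}"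
  proof
    fix \<kappa> assume "\<kappa> \<in># M"
    then have "2 \<le> \<kappa>" "\<kappa> div 2 \<le> N" using part_le[OF assms] assms by (auto simp: over_msets_def)
    then have "\<kappa> div 2 \<in> {1..N}" by auto
    moreover have "\<kappa> = 2 * (\<kappa> div 2) \<or> \<kappa> = Suc (2 * (\<kappa> div 2))" by presburger
    ultimately show "\<kappa> \<in> (\<lambda>k. 2 * k) ` {1..N} \<union> (\<lambda>k. Suc (2 * k)) ` {1..N}" by blast
  qed
  have "int (size M) = (\<Sum>\<kappa>\<in>(\<lambda>k. 2 * k) ` {1..N} \<union> (\<lambda>k. Suc (2 * k)) ` {1..N}. int (count M \<kappa>))"
    unfolding size_multiset_overloaded_eq of_nat_sum
    using sub by (intro sum.mono_neutral_left) (auto simp: not_in_iff)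
  also have "\<dots> = (\<Sum>\<kappa>\<in>(\<lambda>k. 2 * k) ` {1..N}. int (count M \<kappa>)) + (\<Sum>\<kappa>\<in>(\<lambda>k. Suc (2 * k)) ` {1..N}. int (count M \<kappa>))"
    by (rule sum.union_disjoint) (auto, presburger)
  also have "\<dots> = (\<Sum>k=1..N. int (count M (2 * k))) + (\<Sum>k=1..N. int (count M (Suc (2 * k))))"
    by (simp add: sum.reindex inj_on_def)
  finally show ?thesis by (simp add: sum.distrib)
qed

lemma num_odd_eq_sum_count:
  assumes "M \<in> over_msets N"
  shows "int (num_odd M) = (\<Sum>k=1..N. of_bool (odd k) * int (count M (2 * k)))"
proof -
  have "int (num_odd M) = (\<Sum>\<kappa>\<in>set_mset {#\<kappa> \<in># M. \<kappa> mod 4 = 2#}. int (count {#\<kappa> \<in># M. \<kappa> mod 4 = 2#} \<kappa>))"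
    unfolding num_odd_def size_multiset_overloaded_eq of_nat_sum ..
  also have "\<dots> = (\<Sum>\<kappa>\<in>(\<lambda>k. 2 * k) ` {k \<in> {1..N}. odd k}. int (count M \<kappa>))"
  proof (rule sum.mono_neutral_cong_left)
    show "set_mset {#\<kappa> \<in># M. \<kappa> mod 4 = 2#} \<subseteq> (\<lambda>k. 2 * k) ` {k \<in> {1..N}. odd k}"
    proof
      fix \<kappa> assume "\<kappa> \<in># {#\<kappa> \<in># M. \<kappa> mod 4 = 2#}"
      then have *: "\<kappa> \<in># M" "\<kappa> mod 4 = 2" by auto
      then have "\<kappa> div 2 \<le> N" using part_le[OF assms] by blast
      moreover have "odd (\<kappa> div 2)" "\<kappa> = 2 * (\<kappa> div 2)" using *(2) by presburger+
      moreover from this have "1 \<le> \<kappa> div 2" by (cases "\<kappa> div 2 = 0") auto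
      ultimately show "\<kappa> \<in> (\<lambda>k. 2 * k) ` {k \<in> {1..N}. odd k}" by (metis (mono_tags, lifting) atLeastAtMost_iff imageI mem_Collect_eq)
    qed
    have m4: "2 * k mod 4 = 2" if "odd k" for k :: nat using that by presburger
    show "\<forall>\<kappa>\<in>(\<lambda>k. 2 * k) ` {k \<in> {1..N}. odd k} - set_mset {#\<kappa> \<in># M. \<kappa> mod 4 = 2#}. int (count M \<kappa>) = 0"
      using m4 by (auto simp: not_in_iff)
    show "int (count {#\<kappa> \<in># M. \<kappa> mod 4 = 2#} \<kappa>) = int (count M \<kappa>)" if "\<kappa> \<in># {#\<kappa> \<in># M. \<kappa> mod 4 = 2#}" for \<kappa>
      using that by simp
  qed auto
  also have "\<dots> = (\<Sum>k\<in>{k \<in> {1..N}. odd k}. int (count M (2 * k)))"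
    by (simp add: sum.reindex inj_on_def)
  also have "\<dots> = (\<Sum>k=1..N. of_bool (odd k) * int (count M (2 * k)))"
    by (rule sum.mono_neutral_cong_left) auto
  finally show ?thesis .
qed

text \<open>In its use below, \<open>j\<close> is the number of removed copies and \<open>k\<close>
  the size of the part.\<close>

definition parity_series :: "int fps" where
  "parity_series = Abs_fps (\<lambda>i. \<Sum>(j, k)\<in>factor_pairs i. int j * (of_bool (odd j) - of_bool (odd k)))"

lemma factor_pairs_antisym:
  fixes f :: "nat \<Rightarrow> nat \<Rightarrow> int"
  assumes "\<And>j k. f j k = - f k j"
  shows "(\<Sum>(j, k)\<in>factor_pairs i. f j k) = 0"
proof -
  have "(\<Sum>(j, k)\<in>factor_pairs i. f j k) = (\<Sum>(j, k)\<in>factor_pairs i. f k j)"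
    by (rule sum.reindex_bij_witness[of _ prod.swap prod.swap]) (auto simp: factor_pairs_def mult.commute)
  also have "\<dots> = - (\<Sum>(j, k)\<in>factor_pairs i. f j k)"
    unfolding sum_negf[symmetric] case_prod_unfold by (rule sum.cong[OF refl], rule assms)
  finally show ?thesis by simp
qed

text \<open>Both statistics are sums of multiplicities, so the left-hand side becomes a sum over
  \<open>i\<close> removed copies of a part of size \<open>k\<close>. The pairs
  \<open>(i, k)\<close> are then grouped by their product.\<close>

lemma sum_size_minus_odd_gf:
  "(\<Sum>M\<in>over_msets N. int (size M) * (int (size M) - 2 * int (num_odd M))) = (2 * op_gf * parity_series) $ N"
proof -
  define c :: "nat \<Rightarrow> nat \<Rightarrow> int" where "c i k = of_bool (odd i) - of_bool (odd k)" for i k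
  \<comment> \<open>The non-overlined, overlined and odd non-overlined contributions combine to a
    difference of parities, antisymmetric in \<open>i\<close> and \<open>k\<close>.\<close>
  have sgn: "1 + (-1) ^ (i - 1) - 2 * of_bool (odd k) = 2 * c i k" if "0 < i" for i k
    using that by (cases i) (auto simp: c_def)
  have "(\<Sum>M\<in>over_msets N. int (size M) * (int (size M) - 2 * int (num_odd M))) =
    (\<Sum>M\<in>over_msets N. \<Sum>k=1..N. int (count M (2 * k)) * int (size M + 0)
       + int (count M (Suc (2 * k))) * int (size M + 0)
       - 2 * of_bool (odd k) * (int (count M (2 * k)) * int (size M + 0)))"
  proof (rule sum.cong[OF refl])
    fix M assume M: "M \<in> over_msets N"
    have "int (size M) * (int (size M) - 2 * int (num_odd M)) =
      int (size M) * (\<Sum>k=1..N. int (count M (2 * k)) + int (count M (Suc (2 * k))) - 2 * (of_bool (odd k) * int (count M (2 * k))))"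
      unfolding sum_subtractf sum_distrib_left[symmetric]
        size_eq_sum_count[OF M, symmetric] num_odd_eq_sum_count[OF M, symmetric] ..
    then show "int (size M) * (int (size M) - 2 * int (num_odd M)) =
      (\<Sum>k=1..N. int (count M (2 * k)) * int (size M + 0)
       + int (count M (Suc (2 * k))) * int (size M + 0)
       - 2 * of_bool (odd k) * (int (count M (2 * k)) * int (size M + 0)))"
      unfolding sum_distrib_left by (simp add: algebra_simps)
  qed
  also have "\<dots> = (\<Sum>k=1..N. (\<Sum>M\<in>over_msets N. int (count M (2 * k)) * int (size M + 0))
       + (\<Sum>M\<in>over_msets N. int (count M (Suc (2 * k))) * int (size M + 0))
       - 2 * of_bool (odd k) * (\<Sum>M\<in>over_msets N. int (count M (2 * k)) * int (size M + 0)))"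
    by (subst sum.swap) (simp only: sum.distrib sum_subtractf sum_distrib_left)
  also have "\<dots> = (\<Sum>k=1..N. \<Sum>i=1..N. of_bool (i * k \<le> N) * (2 * c i k * shifted_size_sum i (N - i * k)))"
  proof (rule sum.cong[OF refl])
    fix k assume "k \<in> {1..N}"
    then have k: "0 < k" by simp
    show "(\<Sum>M\<in>over_msets N. int (count M (2 * k)) * int (size M + 0))
       + (\<Sum>M\<in>over_msets N. int (count M (Suc (2 * k))) * int (size M + 0))
       - 2 * of_bool (odd k) * (\<Sum>M\<in>over_msets N. int (count M (2 * k)) * int (size M + 0)) =
       (\<Sum>i=1..N. of_bool (i * k \<le> N) * (2 * c i k * shifted_size_sum i (N - i * k)))"
      unfolding sum_nonoverlined_multiplicity[OF k] sum_overlined_multiplicity[OF k]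
        sum_distrib_left sum.distrib[symmetric] sum_subtractf[symmetric]
    proof (rule sum.cong[OF refl])
      fix i assume "i \<in> {1..N}"
      then have "0 < i" by simp
      show "of_bool (i * k \<le> N) * shifted_size_sum (i + 0) (N - i * k)
        + of_bool (i * k \<le> N) * ((-1) ^ (i - 1) * shifted_size_sum (i + 0) (N - i * k))
        - 2 * of_bool (odd k) * (of_bool (i * k \<le> N) * shifted_size_sum (i + 0) (N - i * k)) =
        of_bool (i * k \<le> N) * (2 * c i k * shifted_size_sum i (N - i * k))"
        unfolding sgn[OF \<open>0 < i\<close>, symmetric] by (simp add: algebra_simps)
    qed
  qed
  also have "\<dots> = (\<Sum>(i, k)\<in>{1..N} \<times> {1..N}. of_bool (i * k \<le> N) * (2 * c i k * shifted_size_sum i (N - i * k)))"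
    by (subst sum.swap) (rule sum.cartesian_product)
  also have "\<dots> = (\<Sum>(i, k)\<in>(\<Union>n\<in>{0..N}. factor_pairs n). 2 * c i k * shifted_size_sum i (N - i * k))"
  proof (rule sum.mono_neutral_cong_right)
    show "(\<Union>n\<in>{0..N}. factor_pairs n) \<subseteq> {1..N} \<times> {1..N}"
      using factor_pairs_subset by fastforce
    show "\<forall>x\<in>{1..N} \<times> {1..N} - (\<Union>n\<in>{0..N}. factor_pairs n).
        (case x of (i, k) \<Rightarrow> of_bool (i * k \<le> N) * (2 * c i k * shifted_size_sum i (N - i * k))) = 0"
      by (auto simp: factor_pairs_def)
  qed (auto simp: factor_pairs_def)
  also have "\<dots> = (\<Sum>n=0..N. \<Sum>(i, k)\<in>factor_pairs n. 2 * c i k * shifted_size_sum i (N - i * k))"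
    by (rule sum.UNION_disjoint) (auto simp: finite_factor_pairs, auto simp: factor_pairs_def)
  also have "\<dots> = (\<Sum>n=0..N. 2 * (op_gf $ (N - n) * parity_series $ n))"
  proof (rule sum.cong[OF refl])
    fix n
    \<comment> \<open>\<open>shifted_size_sum i\<close> is \<open>shifted_size_sum 0\<close> plus
      \<open>i\<close> times the number of overpartitions; the first summand then cancels by the
      antisymmetry of \<open>c\<close>.\<close>
    have "(\<Sum>(i, k)\<in>factor_pairs n. 2 * c i k * shifted_size_sum i (N - i * k)) =
      (\<Sum>(i, k)\<in>factor_pairs n. 2 * shifted_size_sum 0 (N - n) * c i k + 2 * op_gf $ (N - n) * (int i * c i k))"
      by (rule sum.cong[OF refl])
        (auto simp: factor_pairs_def shifted_size_sum_def op_gf_nth sum.distrib algebra_simps)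
    also have "\<dots> = 2 * shifted_size_sum 0 (N - n) * (\<Sum>(i, k)\<in>factor_pairs n. c i k)
      + 2 * op_gf $ (N - n) * (\<Sum>(i, k)\<in>factor_pairs n. int i * c i k)"
      by (simp only: case_prod_unfold sum.distrib sum_distrib_left)
    also have "(\<Sum>(i, k)\<in>factor_pairs n. c i k) = 0"
      by (rule factor_pairs_antisym) (simp add: c_def)
    finally show "(\<Sum>(i, k)\<in>factor_pairs n. 2 * c i k * shifted_size_sum i (N - i * k)) =
        2 * (op_gf $ (N - n) * parity_series $ n)"
      by (simp add: parity_series_def c_def)
  qed
  finally show ?thesis by (simp only: double_op_gf_mult_nth sum_distrib_left)
qed

section \<open>Indefinite forms and a genus character\<close>

text \<open>Both the quadratic character modulo 3 and the residue chosen from -1, 0, 1; the second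
  reading turns character sums into congruences.\<close>

definition chi3 :: "int \<Rightarrow> int" where
  "chi3 t = (if t mod 3 = 2 then -1 else t mod 3)"

text \<open>For \<open>3 dvd x\<^sup>2 + d * e\<close> the binary quadratic form \<open>d u\<^sup>2 + 2 x u v - e v\<^sup>2\<close> is modulo 3
  a multiple of the square of a linear form; the multiplier is the genus character below.\<close>

definition genus_char :: "int \<Rightarrow> int \<Rightarrow> int \<Rightarrow> int" where
  "genus_char d x e = chi3 ((d - e) * (1 + x\<^sup>2))"

text \<open>A triple stands for the form \<open>d u\<^sup>2 + 2 x u v - e v\<^sup>2\<close> of
  discriminant \<open>4 * N\<close>; positivity of \<open>d\<close> and \<open>e\<close> leaves
  finitely many.\<close>

definition indef_forms :: "int \<Rightarrow> (int \<times> int \<times> int) set" where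
  "indef_forms N = {(d, x, e). 0 < d \<and> 0 < e \<and> x\<^sup>2 + d * e = N}"

definition char_sum :: "int \<Rightarrow> (int \<Rightarrow> int \<Rightarrow> int \<Rightarrow> bool) \<Rightarrow> int" where
  "char_sum N P = (\<Sum>(d, x, e)\<in>{(d, x, e) \<in> indef_forms N. P d x e}. genus_char d x e)"

lemma chi3_cong: "s mod 3 = t mod 3 \<Longrightarrow> chi3 s = chi3 t"
  by (simp add: chi3_def)

lemma chi3_minus: "chi3 (- t) = - chi3 t"
proof -
  have "t mod 3 = 0 \<and> (- t) mod 3 = 0 \<or> t mod 3 = 1 \<and> (- t) mod 3 = 2 \<or> t mod 3 = 2 \<and> (- t) mod 3 = 1"
    by presburger
  then show ?thesis by (auto simp: chi3_def)
qed

lemma chi3_mod: "chi3 t mod 3 = t mod 3"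
  by (auto simp: chi3_def)

lemma mod_3_cases: "(t::int) mod 3 \<in> {0, 1, 2}"
  by auto

text \<open>The new triple is the negated form with its variables exchanged, and -1 is a non-residue
  modulo 3.\<close>

lemma genus_char_swap: "genus_char e (- x) d = - genus_char d x e"
proof -
  have "(e - d) * (1 + (- x)\<^sup>2) = - ((d - e) * (1 + x\<^sup>2))" by (simp add: algebra_simps)
  then show ?thesis by (simp only: genus_char_def chi3_minus)
qed

lemma genus_char_neg: "genus_char d (- x) e = genus_char d x e"
  by (simp add: genus_char_def)

text \<open>A polynomial congruence modulo 3 under a constraint \<open>H\<close> is decided by the
  27 residue triples; the first three assumptions say that the functions depend only on
  residues.\<close>

lemma mod_3_check:
  fixes F G H :: "int \<Rightarrow> int \<Rightarrow> int \<Rightarrow> int"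
  assumes "\<And>a b c. [H a b c = H (a mod 3) (b mod 3) (c mod 3)] (mod 3)"
    and "\<And>a b c. [F a b c = F (a mod 3) (b mod 3) (c mod 3)] (mod 3)"
    and "\<And>a b c. [G a b c = G (a mod 3) (b mod 3) (c mod 3)] (mod 3)"
    and "\<forall>a\<in>{0, 1, 2}. \<forall>b\<in>{0, 1, 2}. \<forall>c\<in>{0, 1, 2}. H a b c mod 3 = 0 \<longrightarrow> F a b c mod 3 = G a b c mod 3"
    and "3 dvd H a b c"
  shows "F a b c mod 3 = G a b c mod 3"
proof -
  have "H (a mod 3) (b mod 3) (c mod 3) mod 3 = 0"
    using assms(1)[of a b c] assms(5) by (simp add: cong_def)
  then have "F (a mod 3) (b mod 3) (c mod 3) mod 3 = G (a mod 3) (b mod 3) (c mod 3) mod 3"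
    by (rule assms(4)[THEN bspec, THEN bspec, THEN bspec, THEN mp, OF mod_3_cases mod_3_cases mod_3_cases])
  then show ?thesis using assms(2)[of a b c] assms(3)[of a b c] by (simp only: cong_def)
qed

text \<open>Substituting (u - v, -v) for (u, v) gives an equivalent form, with the same values and
  hence the same character.\<close>

lemma genus_char_shift:
  assumes "3 dvd x\<^sup>2 + d * e"
  shows "genus_char d (- (x + d)) (e - d - 2 * x) = genus_char d x e"
proof -
  have "(d - (e - d - 2 * x)) * (1 + (x + d)\<^sup>2) mod 3 = (d - e) * (1 + x\<^sup>2) mod 3"
    by (rule mod_3_check[where H = "\<lambda>d x e. x\<^sup>2 + d * e" and F = "\<lambda>d x e. (d - (e - d - 2 * x)) * (1 + (x + d)\<^sup>2)"
          and G = "\<lambda>d x e. (d - e) * (1 + x\<^sup>2)"];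
        (intro cong_mult cong_add cong_diff cong_pow cong_refl)?; simp add: cong_def assms)
  then show ?thesis unfolding genus_char_def power2_minus by (rule chi3_cong)
qed

text \<open>The next two lemmas pass to half of the form on the index-two sublattice spanned by
  \<open>(1, 1)\<close> and \<open>(1, -1)\<close>.\<close>

lemma genus_char_half:
  assumes "3 dvd x\<^sup>2 + d * (d + 2 * h)"
  shows "genus_char (2 * d) (- (d + x)) (h - x) = - genus_char d x (d + 2 * h)"
proof -
  have "(2 * d - (h - x)) * (1 + (d + x)\<^sup>2) mod 3 = (0 - (d - (d + 2 * h)) * (1 + x\<^sup>2)) mod 3"
    by (rule mod_3_check[where H = "\<lambda>d x h. x\<^sup>2 + d * (d + 2 * h)" and F = "\<lambda>d x h. (2 * d - (h - x)) * (1 + (d + x)\<^sup>2)"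
          and G = "\<lambda>d x h. 0 - (d - (d + 2 * h)) * (1 + x\<^sup>2)"];
        (intro cong_mult cong_add cong_diff cong_pow cong_refl)?; simp add: cong_def assms)
  then show ?thesis unfolding genus_char_def power2_minus chi3_minus[symmetric] diff_0 by (rule chi3_cong)
qed

lemma genus_char_half':
  assumes "3 dvd x\<^sup>2 + d * (d + 2 * h)"
  shows "genus_char (x - h) (d + h) (x + h) = - genus_char d x (d + 2 * h)"
proof -
  have "((x - h) - (x + h)) * (1 + (d + h)\<^sup>2) mod 3 = (0 - (d - (d + 2 * h)) * (1 + x\<^sup>2)) mod 3"
    by (rule mod_3_check[where H = "\<lambda>d x h. x\<^sup>2 + d * (d + 2 * h)" and F = "\<lambda>d x h. ((x - h) - (x + h)) * (1 + (d + h)\<^sup>2)"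
          and G = "\<lambda>d x h. 0 - (d - (d + 2 * h)) * (1 + x\<^sup>2)"];
        (intro cong_mult cong_add cong_diff cong_pow cong_refl)?; simp add: cong_def assms)
  then show ?thesis unfolding genus_char_def chi3_minus[symmetric] diff_0 by (rule chi3_cong)
qed

text \<open>For \<open>e = d + 2 * x\<close> the number \<open>x\<^sup>2 + d * e\<close> is the
  square of \<open>d + x\<close>, hence the shape of the hypothesis.\<close>

lemma genus_char_boundary:
  assumes "3 dvd (d + x)\<^sup>2"
  shows "genus_char x d (x + 2 * d) = - genus_char d x (d + 2 * x)"
proof -
  have "(x - (x + 2 * d)) * (1 + d\<^sup>2) mod 3 = (0 - (d - (d + 2 * x)) * (1 + x\<^sup>2)) mod 3"
    by (rule mod_3_check[where H = "\<lambda>d x _. (d + x)\<^sup>2" and F = "\<lambda>d x _. (x - (x + 2 * d)) * (1 + d\<^sup>2)"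
          and G = "\<lambda>d x _. 0 - (d - (d + 2 * x)) * (1 + x\<^sup>2)" and c = 0];
        (intro cong_mult cong_add cong_diff cong_pow cong_refl)?; simp add: cong_def assms)
  then show ?thesis unfolding genus_char_def chi3_minus[symmetric] diff_0 by (rule chi3_cong)
qed

lemma abs_le_square_int: "\<bar>x\<bar> \<le> x\<^sup>2" for x :: int
proof (cases "x = 0")
  case False
  then have "\<bar>x\<bar> \<le> \<bar>x\<bar>\<^sup>2" by (intro self_le_power) auto
  then show ?thesis by simp
qed simp

lemma finite_indef_forms: "finite (indef_forms N)"
proof (rule finite_subset)
  show "indef_forms N \<subseteq> {1..N} \<times> {-N..N} \<times> {1..N}"
  proof
    fix t assume t: "t \<in> indef_forms N"
    obtain d x e where dxe: "t = (d, x, e)" by (cases t)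
    have *: "0 < d" "0 < e" "x\<^sup>2 + d * e = N" using t by (auto simp: indef_forms_def dxe)
    have "d * 1 \<le> d * e" "1 * e \<le> d * e"
      using * by (intro mult_left_mono mult_right_mono; simp)+
    moreover have "0 \<le> x\<^sup>2" by simp
    ultimately have "d \<le> N" "e \<le> N" "x\<^sup>2 \<le> N" using * by linarith+
    moreover have "\<bar>x\<bar> \<le> x\<^sup>2" by (rule abs_le_square_int)
    ultimately have "- N \<le> x" "x \<le> N" "d \<le> N" "e \<le> N" by linarith+
    then show "t \<in> {1..N} \<times> {-N..N} \<times> {1..N}" using *(1,2) by (simp add: dxe)
  qed
qed auto

section \<open>Substitutions in character sums\<close>

lemma char_sum_split: "char_sum N P = char_sum N (\<lambda>d x e. P d x e \<and> Q d x e) + char_sum N (\<lambda>d x e. P d x e \<and> \<not> Q d x e)"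
proof -
  have "{(d, x, e) \<in> indef_forms N. P d x e} =
      {(d, x, e) \<in> indef_forms N. P d x e \<and> Q d x e} \<union> {(d, x, e) \<in> indef_forms N. P d x e \<and> \<not> Q d x e}"
    by auto
  then show ?thesis unfolding char_sum_def
    by (simp only:) (rule sum.union_disjoint, auto intro: finite_subset[OF _ finite_indef_forms])
qed

lemma char_sum_cong:
  "(\<And>d x e. 0 < d \<Longrightarrow> 0 < e \<Longrightarrow> x\<^sup>2 + d * e = N \<Longrightarrow> P d x e \<longleftrightarrow> Q d x e) \<Longrightarrow> char_sum N P = char_sum N Q"
  unfolding char_sum_def by (rule sum.cong) (auto simp: indef_forms_def)

lemma char_sum_swap: "char_sum N P = - char_sum N (\<lambda>d x e. P e (- x) d)"
  unfolding char_sum_def sum_negf[symmetric]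
  by (rule sum.reindex_bij_witness[of _ "\<lambda>(d, x, e). (e, - x, d)" "\<lambda>(d, x, e). (e, - x, d)"])
    (auto simp: indef_forms_def genus_char_swap mult.commute)

lemma char_sum_neg: "char_sum N P = char_sum N (\<lambda>d x e. P d (- x) e)"
  unfolding char_sum_def
  by (rule sum.reindex_bij_witness[of _ "\<lambda>(d, x, e). (d, - x, e)" "\<lambda>(d, x, e). (d, - x, e)"])
    (auto simp: indef_forms_def genus_char_neg)

text \<open>The inequality says that the form is negative at (1, 1), which is positivity of the new
  last coefficient. The substitution is an involution under which this inequality and the positivity
  of \<open>e\<close> change places.\<close>

lemma char_sum_shift:
  assumes "3 dvd N"
  shows "char_sum N (\<lambda>d x e. d + 2 * x < e \<and> P d x e) =
         char_sum N (\<lambda>d x e. d + 2 * x < e \<and> P d (- (x + d)) (e - d - 2 * x))"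
  unfolding char_sum_def
proof (rule sum.reindex_bij_witness[of _ "\<lambda>(d, x, e). (d, - (x + d), e - d - 2 * x)" "\<lambda>(d, x, e). (d, - (x + d), e - d - 2 * x)"],
    goal_cases)
  case (5 t)
  obtain d x e where t: "t = (d, x, e)" by (cases t)
  then have "genus_char d (- (x + d)) (e - d - 2 * x) = genus_char d x e"
    using 5 assms by (intro genus_char_shift) (simp add: indef_forms_def)
  then show ?case by (simp only: t prod.case)
qed (auto simp: indef_forms_def power2_eq_square algebra_simps)

text \<open>With \<open>e = d + 2 * h\<close> the region is \<open>0 < h < x\<close>. Halving the
  form on the sublattice spanned by (1, 1) and (1, -1) is an involution of this region, and it
  reverses the character because 2 is a non-residue modulo 3.\<close>

lemma char_sum_mixed_zero:
  assumes "3 dvd N"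
  shows "char_sum N (\<lambda>d x e. d < e \<and> even (e - d) \<and> e < d + 2 * x) = 0"
proof -
  let ?P = "\<lambda>d x e::int. d < e \<and> even (e - d) \<and> e < d + 2 * x"
  let ?f = "\<lambda>(d, x, e). (x - (e - d) div 2, d + (e - d) div 2, x + (e - d) div 2)"
  have step: "?f t \<in> {(d, x, e) \<in> indef_forms N. ?P d x e} \<and> ?f (?f t) = t \<and>
      (case ?f t of (d, x, e) \<Rightarrow> genus_char d x e) = - (case t of (d, x, e) \<Rightarrow> genus_char d x e)"
    if t: "t \<in> {(d, x, e) \<in> indef_forms N. ?P d x e}" for t
  proof -
    obtain d x e where dxe: "t = (d, x, e)" by (cases t)
    have "even (e - d)" using t by (simp add: dxe)
    then obtain h where "e - d = 2 * h" by (rule evenE)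
    then have h: "e = d + 2 * h" by simp
    have *: "0 < d" "0 < h" "h < x" "x\<^sup>2 + d * (d + 2 * h) = N"
      using t by (auto simp: dxe h indef_forms_def)
    have "(d + h)\<^sup>2 + (x - h) * (x + h) = N" unfolding *(4)[symmetric] by (simp add: power2_eq_square algebra_simps)
    then show ?thesis
      using * genus_char_half'[of x d h] assms by (auto simp: dxe h indef_forms_def)
  qed
  have "char_sum N ?P = - char_sum N ?P"
    unfolding char_sum_def sum_negf[symmetric]
    by (rule sum.reindex_bij_witness[of _ ?f ?f]) (use step in \<open>simp_all only: minus_minus\<close>)
  then show ?thesis by simp
qed

text \<open>Exchanging \<open>d\<close> and \<open>x\<close> is an involution of this region that
  reverses the character.\<close>

lemma char_sum_boundary_zero:
  assumes "3 dvd N"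
  shows "char_sum N (\<lambda>d x e. d < e \<and> e = d + 2 * x) = 0"
proof -
  let ?P = "\<lambda>d x e::int. d < e \<and> e = d + 2 * x"
  let ?f = "\<lambda>(d, x, e). (x, d, x + 2 * d) :: int \<times> int \<times> int"
  have step: "?f t \<in> {(d, x, e) \<in> indef_forms N. ?P d x e} \<and> ?f (?f t) = t \<and>
      (case ?f t of (d, x, e) \<Rightarrow> genus_char d x e) = - (case t of (d, x, e) \<Rightarrow> genus_char d x e)"
    if t: "t \<in> {(d, x, e) \<in> indef_forms N. ?P d x e}" for t
  proof -
    obtain d x e where dxe: "t = (d, x, e)" by (cases t)
    have *: "0 < d" "0 < x" "x\<^sup>2 + d * (d + 2 * x) = N" "e = d + 2 * x"
      using t by (auto simp: dxe indef_forms_def)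
    have "d\<^sup>2 + x * (x + 2 * d) = N" "(d + x)\<^sup>2 = N"
      unfolding *(3)[symmetric] by (simp_all add: power2_eq_square algebra_simps)
    then show ?thesis
      using * genus_char_boundary[of d x] assms by (auto simp: dxe indef_forms_def)
  qed
  have "char_sum N ?P = - char_sum N ?P"
    unfolding char_sum_def sum_negf[symmetric]
    by (rule sum.reindex_bij_witness[of _ ?f ?f]) (use step in \<open>simp_all only: minus_minus\<close>)
  then show ?thesis by simp
qed

text \<open>Again half of the form, now in the basis (2, 0), (-1, -1) of the sublattice. Negativity
  at (1, 1) becomes positivity of the last coefficient, and negativity at (1, -1) becomes the
  inequality on the right-hand side.\<close>

lemma char_sum_half:
  assumes "3 dvd N"
  shows "char_sum N (\<lambda>d x e. even (e - d) \<and> d + 2 * x < e \<and> d - 2 * x < e) =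
       - char_sum N (\<lambda>d x e. d + 2 * x < e \<and> even d)"
proof -
  let ?A = "{(d, x, e) \<in> indef_forms N. even (e - d) \<and> d + 2 * x < e \<and> d - 2 * x < e}"
  let ?B = "{(d, x, e) \<in> indef_forms N. d + 2 * x < e \<and> even d}"
  let ?f = "\<lambda>(d, x, e). (2 * d, - (d + x), (e - d) div 2 - x) :: int \<times> int \<times> int"
  let ?g = "\<lambda>(d, x, e). (d div 2, - (x + d div 2), d div 2 + 2 * (e - x - d div 2)) :: int \<times> int \<times> int"
  have f: "?f t \<in> ?B \<and> ?g (?f t) = t \<and>
      - (case ?f t of (d, x, e) \<Rightarrow> genus_char d x e) = (case t of (d, x, e) \<Rightarrow> genus_char d x e)" if t: "t \<in> ?A" for t
  proof -
    obtain d x e where dxe: "t = (d, x, e)" by (cases t)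
    have "even (e - d)" using t by (simp add: dxe)
    then obtain h where "e - d = 2 * h" by (rule evenE)
    then have h: "e = d + 2 * h" by simp
    have *: "0 < d" "x < h" "- x < h" "x\<^sup>2 + d * (d + 2 * h) = N"
      using t by (auto simp: dxe h indef_forms_def)
    have "(d + x)\<^sup>2 + 2 * d * (h - x) = N" unfolding *(4)[symmetric] by (simp add: power2_eq_square algebra_simps)
    moreover have "(- (d + x))\<^sup>2 = (d + x)\<^sup>2" by (rule power2_minus)
    ultimately show ?thesis
      using * genus_char_half[of x d h] assms by (auto simp: dxe h indef_forms_def)
  qed
  have g: "?g t \<in> ?A \<and> ?f (?g t) = t" if t: "t \<in> ?B" for t
  proof -
    obtain D x e where dxe: "t = (D, x, e)" by (cases t)
    obtain d where d: "D = 2 * d" using t dxe by (auto elim!: evenE)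
    have *: "0 < d" "0 < e" "2 * d + 2 * x < e" "x\<^sup>2 + 2 * d * e = N"
      using t by (auto simp: dxe d indef_forms_def)
    have "(x + d)\<^sup>2 + d * (d + 2 * (e - x - d)) = N" unfolding *(4)[symmetric] by (simp add: power2_eq_square algebra_simps)
    moreover have "(- (x + d))\<^sup>2 = (x + d)\<^sup>2" by (rule power2_minus)
    ultimately show ?thesis
      using * by (auto simp: dxe d indef_forms_def)
  qed
  show ?thesis
    unfolding char_sum_def sum_negf[symmetric]
    by (rule sum.reindex_bij_witness[of _ ?g ?f])
      (rule f[THEN conjunct2, THEN conjunct1] f[THEN conjunct1] g[THEN conjunct2] g[THEN conjunct1]
        f[THEN conjunct2, THEN conjunct2], assumption)+
qed

lemma char_sum_diag_zero: "char_sum N (\<lambda>d x e. d = e \<and> P d x e) = 0"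
  unfolding char_sum_def by (rule sum.neutral) (auto simp: genus_char_def chi3_def)

lemma char_sum_upper_zero:
  assumes "3 dvd N"
  shows "char_sum N (\<lambda>d x e. d < e \<and> even (e - d) \<and> \<not> d + 2 * x < e) = 0"
proof -
  have "char_sum N (\<lambda>d x e. d < e \<and> even (e - d) \<and> \<not> d + 2 * x < e) =
      char_sum N (\<lambda>d x e. (d < e \<and> even (e - d) \<and> \<not> d + 2 * x < e) \<and> e < d + 2 * x) +
      char_sum N (\<lambda>d x e. (d < e \<and> even (e - d) \<and> \<not> d + 2 * x < e) \<and> \<not> e < d + 2 * x)"
    by (rule char_sum_split)
  also have "char_sum N (\<lambda>d x e. (d < e \<and> even (e - d) \<and> \<not> d + 2 * x < e) \<and> e < d + 2 * x) =
      char_sum N (\<lambda>d x e. d < e \<and> even (e - d) \<and> e < d + 2 * x)"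
    by (rule char_sum_cong) linarith
  also have "char_sum N (\<lambda>d x e. (d < e \<and> even (e - d) \<and> \<not> d + 2 * x < e) \<and> \<not> e < d + 2 * x) =
      char_sum N (\<lambda>d x e. d < e \<and> e = d + 2 * x)"
    by (rule char_sum_cong) auto
  finally show ?thesis using char_sum_mixed_zero[OF assms] char_sum_boundary_zero[OF assms] by simp
qed

text \<open>The forms counted are negative at (1, 1) and (1, -1).
  \<open>char_sum_same_parity\<close> and \<open>char_sum_even\<close> produce one and two copies of
  this sum, whence the final factor 3.\<close>

definition half_sum :: "int \<Rightarrow> int" where
  "half_sum N = char_sum N (\<lambda>d x e. even (e - d) \<and> d + 2 * x < e \<and> d - 2 * x < e)"

text \<open>Split by the sign at (1, -1). The forms that are not negative there become the vanishing
  upper region under \<open>x\<close> to \<open>- x\<close>.\<close>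

lemma char_sum_lower:
  assumes "3 dvd N"
  shows "char_sum N (\<lambda>d x e. d < e \<and> even (e - d) \<and> d + 2 * x < e) = half_sum N"
proof -
  have "char_sum N (\<lambda>d x e. d < e \<and> even (e - d) \<and> d + 2 * x < e) =
      char_sum N (\<lambda>d x e. (d < e \<and> even (e - d) \<and> d + 2 * x < e) \<and> d - 2 * x < e) +
      char_sum N (\<lambda>d x e. (d < e \<and> even (e - d) \<and> d + 2 * x < e) \<and> \<not> d - 2 * x < e)"
    by (rule char_sum_split)
  also have "char_sum N (\<lambda>d x e. (d < e \<and> even (e - d) \<and> d + 2 * x < e) \<and> d - 2 * x < e) = half_sum N"
    unfolding half_sum_def by (rule char_sum_cong) linarith
  also have "char_sum N (\<lambda>d x e. (d < e \<and> even (e - d) \<and> d + 2 * x < e) \<and> \<not> d - 2 * x < e) =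
      char_sum N (\<lambda>d x e. (d < e \<and> even (e - d) \<and> d + 2 * (- x) < e) \<and> \<not> d - 2 * (- x) < e)"
    by (rule char_sum_neg)
  also have "\<dots> = char_sum N (\<lambda>d x e. d < e \<and> even (e - d) \<and> \<not> d + 2 * x < e)"
    by (rule char_sum_cong) linarith
  finally show ?thesis using char_sum_upper_zero[OF assms] by simp
qed

lemma char_sum_same_parity:
  assumes "3 dvd N"
  shows "char_sum N (\<lambda>d x e. d < e \<and> even (e - d)) = half_sum N"
proof -
  have "char_sum N (\<lambda>d x e. d < e \<and> even (e - d)) =
      char_sum N (\<lambda>d x e. (d < e \<and> even (e - d)) \<and> d + 2 * x < e) +
      char_sum N (\<lambda>d x e. (d < e \<and> even (e - d)) \<and> \<not> d + 2 * x < e)"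
    by (rule char_sum_split)
  then show ?thesis
    using char_sum_lower[OF assms] char_sum_upper_zero[OF assms] by (simp only: conj_assoc add_0_right)
qed

text \<open>The shift turns the condition on \<open>e\<close> into equality of the parities of
  \<open>d\<close> and \<open>e\<close>. The forms with \<open>d < e\<close> give
  \<open>half_sum\<close>; swapping the others leads to the mixed and diagonal regions, both of sum
  zero.\<close>

lemma char_sum_lower_even:
  assumes "3 dvd N"
  shows "char_sum N (\<lambda>d x e. d + 2 * x < e \<and> even e) = half_sum N"
proof -
  have "char_sum N (\<lambda>d x e. d + 2 * x < e \<and> even e) =
      char_sum N (\<lambda>d x e. d + 2 * x < e \<and> even (e - d - 2 * x))"
    by (rule char_sum_shift[OF assms, of "\<lambda>d x e. even e"])
  also have "\<dots> = char_sum N (\<lambda>d x e. even (e - d) \<and> d + 2 * x < e)"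
    by (rule char_sum_cong) auto
  also have "\<dots> = char_sum N (\<lambda>d x e. (even (e - d) \<and> d + 2 * x < e) \<and> d < e) +
      char_sum N (\<lambda>d x e. (even (e - d) \<and> d + 2 * x < e) \<and> \<not> d < e)"
    by (rule char_sum_split)
  also have "char_sum N (\<lambda>d x e. (even (e - d) \<and> d + 2 * x < e) \<and> d < e) = half_sum N"
    unfolding char_sum_lower[OF assms, symmetric] by (rule char_sum_cong) blast
  also have "char_sum N (\<lambda>d x e. (even (e - d) \<and> d + 2 * x < e) \<and> \<not> d < e) =
      - char_sum N (\<lambda>d x e. (even (d - e) \<and> e + 2 * (- x) < d) \<and> \<not> e < d)"
    by (rule char_sum_swap)
  also have "char_sum N (\<lambda>d x e. (even (d - e) \<and> e + 2 * (- x) < d) \<and> \<not> e < d) =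
      char_sum N (\<lambda>d x e. ((even (d - e) \<and> e + 2 * (- x) < d) \<and> \<not> e < d) \<and> d < e) +
      char_sum N (\<lambda>d x e. ((even (d - e) \<and> e + 2 * (- x) < d) \<and> \<not> e < d) \<and> \<not> d < e)"
    by (rule char_sum_split)
  also have "char_sum N (\<lambda>d x e. ((even (d - e) \<and> e + 2 * (- x) < d) \<and> \<not> e < d) \<and> d < e) =
      char_sum N (\<lambda>d x e. d < e \<and> even (e - d) \<and> e < d + 2 * x)"
    by (rule char_sum_cong) auto
  also have "char_sum N (\<lambda>d x e. ((even (d - e) \<and> e + 2 * (- x) < d) \<and> \<not> e < d) \<and> \<not> d < e) =
      char_sum N (\<lambda>d x e. d = e \<and> 0 < x)"
    by (rule char_sum_cong) auto
  finally show ?thesis using char_sum_mixed_zero[OF assms] char_sum_diag_zero by simp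
qed

text \<open>Compare \<open>d + 2 * x\<close> with \<open>e\<close>. The smaller case is
  \<open>char_sum_lower_even\<close>; the larger one is swapped into the range of
  \<open>char_sum_half\<close>, where two signs cancel; equality is antisymmetric under the
  swap.\<close>

lemma char_sum_even:
  assumes "3 dvd N"
  shows "char_sum N (\<lambda>d x e. even e) = 2 * half_sum N"
proof -
  have "char_sum N (\<lambda>d x e. even e) = char_sum N (\<lambda>d x e. even e \<and> d + 2 * x < e) +
      char_sum N (\<lambda>d x e. even e \<and> \<not> d + 2 * x < e)"
    by (rule char_sum_split)
  also have "char_sum N (\<lambda>d x e. even e \<and> d + 2 * x < e) = half_sum N"
    unfolding char_sum_lower_even[OF assms, symmetric] by (rule char_sum_cong) blast
  also have "char_sum N (\<lambda>d x e. even e \<and> \<not> d + 2 * x < e) =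
      char_sum N (\<lambda>d x e. (even e \<and> \<not> d + 2 * x < e) \<and> e < d + 2 * x) +
      char_sum N (\<lambda>d x e. (even e \<and> \<not> d + 2 * x < e) \<and> \<not> e < d + 2 * x)"
    by (rule char_sum_split)
  also have "char_sum N (\<lambda>d x e. (even e \<and> \<not> d + 2 * x < e) \<and> e < d + 2 * x) = half_sum N"
  proof -
    have "char_sum N (\<lambda>d x e. (even e \<and> \<not> d + 2 * x < e) \<and> e < d + 2 * x) =
        - char_sum N (\<lambda>d x e. (even d \<and> \<not> e + 2 * (- x) < d) \<and> d < e + 2 * (- x))"
      by (rule char_sum_swap)
    also have "char_sum N (\<lambda>d x e. (even d \<and> \<not> e + 2 * (- x) < d) \<and> d < e + 2 * (- x)) =
        char_sum N (\<lambda>d x e. d + 2 * x < e \<and> even d)"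
      by (rule char_sum_cong) auto
    finally show ?thesis using char_sum_half[OF assms] by (simp add: half_sum_def)
  qed
  also have "char_sum N (\<lambda>d x e. (even e \<and> \<not> d + 2 * x < e) \<and> \<not> e < d + 2 * x) = 0"
  proof -
    have "char_sum N (\<lambda>d x e. (even e \<and> \<not> d + 2 * x < e) \<and> \<not> e < d + 2 * x) =
        - char_sum N (\<lambda>d x e. (even d \<and> \<not> e + 2 * (- x) < d) \<and> \<not> d < e + 2 * (- x))"
      by (rule char_sum_swap)
    also have "char_sum N (\<lambda>d x e. (even d \<and> \<not> e + 2 * (- x) < d) \<and> \<not> d < e + 2 * (- x)) =
        char_sum N (\<lambda>d x e. (even e \<and> \<not> d + 2 * x < e) \<and> \<not> e < d + 2 * x)"
    proof (rule char_sum_cong)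
      fix d x e :: int
      have "even d \<longleftrightarrow> even e" if "e = d + 2 * x" using that by simp
      then show "((even d \<and> \<not> e + 2 * (- x) < d) \<and> \<not> d < e + 2 * (- x)) \<longleftrightarrow>
          ((even e \<and> \<not> d + 2 * x < e) \<and> \<not> e < d + 2 * x)" by linarith
    qed
    finally show ?thesis by simp
  qed
  finally show ?thesis by simp
qed

text \<open>The swap cancels the forms with \<open>d\<close> and \<open>e\<close> both even, and
  moves those with \<open>d > e\<close> across the diagonal at the cost of a sign.\<close>

lemma char_sum_opposite_parity:
  "char_sum N (\<lambda>d x e. even e) =
     char_sum N (\<lambda>d x e. d < e \<and> odd d \<and> even e) - char_sum N (\<lambda>d x e. d < e \<and> even d \<and> odd e)"
proof -
  have "char_sum N (\<lambda>d x e. even e) = char_sum N (\<lambda>d x e. even e \<and> even d) + char_sum N (\<lambda>d x e. even e \<and> odd d)"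
    by (rule char_sum_split)
  also have "char_sum N (\<lambda>d x e. even e \<and> even d) = 0"
  proof -
    have "char_sum N (\<lambda>d x e. even e \<and> even d) = - char_sum N (\<lambda>d x e. even d \<and> even e)"
      by (rule char_sum_swap)
    also have "char_sum N (\<lambda>d x e. even d \<and> even e) = char_sum N (\<lambda>d x e. even e \<and> even d)"
      by (rule char_sum_cong) blast
    finally show ?thesis by simp
  qed
  also have "char_sum N (\<lambda>d x e. even e \<and> odd d) = char_sum N (\<lambda>d x e. (even e \<and> odd d) \<and> d < e)
      + char_sum N (\<lambda>d x e. (even e \<and> odd d) \<and> \<not> d < e)"
    by (rule char_sum_split)
  also have "char_sum N (\<lambda>d x e. (even e \<and> odd d) \<and> \<not> d < e) =
      - char_sum N (\<lambda>d x e. (even d \<and> odd e) \<and> \<not> e < d)"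
    by (rule char_sum_swap)
  also have "char_sum N (\<lambda>d x e. (even d \<and> odd e) \<and> \<not> e < d) = char_sum N (\<lambda>d x e. d < e \<and> even d \<and> odd e)"
  proof (rule char_sum_cong)
    fix d x e :: int
    have "d \<noteq> e" if "even d" "odd e" using that by auto
    then show "((even d \<and> odd e) \<and> \<not> e < d) \<longleftrightarrow> d < e \<and> even d \<and> odd e" by linarith
  qed
  also have "char_sum N (\<lambda>d x e. (even e \<and> odd d) \<and> d < e) = char_sum N (\<lambda>d x e. d < e \<and> odd d \<and> even e)"
    by (rule char_sum_cong) blast
  finally show ?thesis by simp
qed

definition int_sgn :: "int \<Rightarrow> int" where
  "int_sgn t = (if even t then 1 else -1)"

text \<open>Up to the global sign, equal parities contribute \<open>half_sum\<close>, while the two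
  kinds of opposite parity enter with opposite signs and form \<open>char_sum_even\<close>, which is
  twice \<open>half_sum\<close>.\<close>

lemma indef_forms_signed_sum:
  assumes "3 dvd N"
  shows "(\<Sum>(d, x, e)\<in>{(d, x, e) \<in> indef_forms N. d < e}. int_sgn (x + e) * genus_char d x e) =
    int_sgn N * (3 * half_sum N)"
proof -
  let ?S = "{(d, x, e) \<in> indef_forms N. d < e}"
  have fin: "finite ?S" by (rule finite_subset[OF _ finite_indef_forms]) auto
  \<comment> \<open>Modulo 2, \<open>x + e - N\<close> is \<open>e * (1 - d)\<close>, which is odd
    exactly for even \<open>d\<close> and odd \<open>e\<close>.\<close>
  have sgn: "int_sgn (x + e) = int_sgn N * (1 - 2 * of_bool (even d \<and> odd e))"
    if "(d, x, e) \<in> ?S" for d x e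
  proof -
    have N: "N = x\<^sup>2 + d * e" using that by (simp add: indef_forms_def)
    show ?thesis unfolding int_sgn_def N by auto
  qed
  have "(\<Sum>(d, x, e)\<in>?S. int_sgn (x + e) * genus_char d x e) =
      (\<Sum>(d, x, e)\<in>?S. int_sgn N * (genus_char d x e - 2 * (of_bool (even d \<and> odd e) * genus_char d x e)))"
  proof (rule sum.cong[OF refl])
    fix t assume t: "t \<in> ?S"
    obtain d x e where dxe: "t = (d, x, e)" by (cases t)
    show "(case t of (d, x, e) \<Rightarrow> int_sgn (x + e) * genus_char d x e) =
        (case t of (d, x, e) \<Rightarrow> int_sgn N * (genus_char d x e - 2 * (of_bool (even d \<and> odd e) * genus_char d x e)))"
      unfolding dxe prod.case sgn[OF t[unfolded dxe]] by (simp only: algebra_simps mult_1)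
  qed
  also have "\<dots> = int_sgn N * (char_sum N (\<lambda>d x e. d < e) -
      2 * (\<Sum>(d, x, e)\<in>?S. of_bool (even d \<and> odd e) * genus_char d x e))"
    by (simp only: case_prod_unfold sum_distrib_left sum_subtractf char_sum_def right_diff_distrib)
  also have "(\<Sum>(d, x, e)\<in>?S. of_bool (even d \<and> odd e) * genus_char d x e) =
      char_sum N (\<lambda>d x e. d < e \<and> even d \<and> odd e)"
    unfolding char_sum_def by (rule sum.mono_neutral_cong_right[OF fin]) auto
  also have "char_sum N (\<lambda>d x e. d < e) = char_sum N (\<lambda>d x e. d < e \<and> even (e - d)) +
      char_sum N (\<lambda>d x e. d < e \<and> odd (e - d))"
    by (rule char_sum_split)
  also have "char_sum N (\<lambda>d x e. d < e \<and> odd (e - d)) =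
      char_sum N (\<lambda>d x e. (d < e \<and> odd (e - d)) \<and> even e) + char_sum N (\<lambda>d x e. (d < e \<and> odd (e - d)) \<and> odd e)"
    by (rule char_sum_split)
  also have "char_sum N (\<lambda>d x e. (d < e \<and> odd (e - d)) \<and> even e) = char_sum N (\<lambda>d x e. d < e \<and> odd d \<and> even e)"
    by (rule char_sum_cong) auto
  also have "char_sum N (\<lambda>d x e. (d < e \<and> odd (e - d)) \<and> odd e) = char_sum N (\<lambda>d x e. d < e \<and> even d \<and> odd e)"
    by (rule char_sum_cong) auto
  finally show ?thesis
    using char_sum_same_parity[OF assms] char_sum_even[OF assms] char_sum_opposite_parity[of N]
    by (simp add: algebra_simps)
qed

lemma indef_forms_signed_sum_cong:
  assumes "3 dvd N"
  shows "3 dvd (\<Sum>(d, x, e)\<in>{(d, x, e) \<in> indef_forms N. d < e}. int_sgn (x + e) * ((1 + x\<^sup>2) * (e - d)))"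
proof -
  let ?S = "{(d, x, e) \<in> indef_forms N. d < e}"
  have "[(\<Sum>(d, x, e)\<in>?S. int_sgn (x + e) * ((1 + x\<^sup>2) * (e - d))) =
      (\<Sum>(d, x, e)\<in>?S. int_sgn (x + e) * (- genus_char d x e))] (mod 3)"
  proof (rule cong_sum)
    fix t :: "int \<times> int \<times> int"
    obtain d x e where t: "t = (d, x, e)" by (cases t)
    have "(1 + x\<^sup>2) * (e - d) = - ((d - e) * (1 + x\<^sup>2))" by (simp add: algebra_simps)
    moreover have "[- ((d - e) * (1 + x\<^sup>2)) = - genus_char d x e] (mod 3)"
      by (rule cong_minus_minus_iff[THEN iffD2]) (simp only: cong_def genus_char_def chi3_mod)
    ultimately show "[(case t of (d, x, e) \<Rightarrow> int_sgn (x + e) * ((1 + x\<^sup>2) * (e - d))) =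
        (case t of (d, x, e) \<Rightarrow> int_sgn (x + e) * (- genus_char d x e))] (mod 3)"
      unfolding t prod.case by (intro cong_mult cong_refl) (simp only:)
  qed
  also have "(\<Sum>(d, x, e)\<in>?S. int_sgn (x + e) * (- genus_char d x e)) = - (int_sgn N * (3 * half_sum N))"
    unfolding indef_forms_signed_sum[OF assms, symmetric] by (simp add: case_prod_unfold sum_negf)
  finally show ?thesis by (rule cong_dvd_iff[THEN iffD2]) simp
qed

section \<open>Sections modulo 3\<close>

lemma double_fps_nth: "(2 * F) $ n = 2 * F $ n" for F :: "int fps"
  by (simp only: mult_2 fps_add_nth)

lemma fps_3_dvd_iff: "3 dvd (F :: int fps) \<longleftrightarrow> (\<forall>n. 3 dvd F $ n)"
proof
  assume "3 dvd F"
  then obtain G where G: "F = 3 * G" by (rule dvdE)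
  have "F $ n = 3 * G $ n" for n unfolding G by (simp add: numeral_fps_const)
  then show "\<forall>n. 3 dvd F $ n" by simp
next
  assume *: "\<forall>n. 3 dvd F $ n"
  have "F = 3 * Abs_fps (\<lambda>n. F $ n div 3)"
    using * by (intro fps_ext) (simp add: numeral_fps_const)
  then show "3 dvd F" by (rule dvdI)
qed

definition section3 :: "nat \<Rightarrow> int fps \<Rightarrow> int fps" where
  "section3 r F = Abs_fps (\<lambda>n. if n mod 3 = r then F $ n else 0)"

definition supported3 :: "nat \<Rightarrow> int fps \<Rightarrow> bool" where
  "supported3 r F \<longleftrightarrow> (\<forall>n. n mod 3 \<noteq> r \<longrightarrow> F $ n = 0)"

lemma section3_nth: "section3 r F $ n = (if n mod 3 = r then F $ n else 0)"
  by (simp add: section3_def)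

lemma section3_add: "section3 r (F + G) = section3 r F + section3 r G"
  by (rule fps_ext) (simp add: section3_nth)

lemma supported3_section3: "supported3 r (section3 r F)"
  by (simp add: supported3_def section3_nth)

lemma section3_supported: "supported3 s F \<Longrightarrow> section3 r F = (if r = s then F else 0)"
  by (rule fps_ext) (auto simp: section3_nth supported3_def)

lemma section3_sum: "F = section3 0 F + section3 1 F + section3 2 F"
proof (rule fps_ext)
  fix n :: nat
  have "n mod 3 = 0 \<or> n mod 3 = 1 \<or> n mod 3 = 2" by presburger
  then show "F $ n = (section3 0 F + section3 1 F + section3 2 F) $ n"
    by (auto simp: section3_nth)
qed

lemma supported3_mult:
  assumes "supported3 r F" "supported3 s G"
  shows "supported3 ((r + s) mod 3) (F * G)"
  unfolding supported3_def
proof (intro allI impI)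
  fix n assume n: "n mod 3 \<noteq> (r + s) mod 3"
  have "F $ i * G $ (n - i) = 0" if "i \<le> n" for i
  proof (cases "i mod 3 = r \<and> (n - i) mod 3 = s")
    case True
    then have "(i + (n - i)) mod 3 = (r + s) mod 3" by (metis mod_add_eq)
    then show ?thesis using n that by simp
  next
    case False
    then show ?thesis using assms by (auto simp: supported3_def)
  qed
  then show "(F * G) $ n = 0" unfolding fps_mult_nth by (intro sum.neutral) simp
qed

lemma section3_mult:
  assumes "F = section3 0 F + section3 1 F"
  shows "section3 0 (F * G) = section3 0 F * section3 0 G + section3 1 F * section3 2 G"
    and "section3 1 (F * G) = section3 0 F * section3 1 G + section3 1 F * section3 0 G"
    and "section3 2 (F * G) = section3 0 F * section3 2 G + section3 1 F * section3 1 G"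
proof -
  let ?a = "section3 0 F" and ?b = "section3 1 F"
  have "F * G = (?a + ?b) * (section3 0 G + section3 1 G + section3 2 G)"
    using assms section3_sum[of G] by metis
  also have "\<dots> = ?a * section3 0 G + ?a * section3 1 G + ?a * section3 2 G
      + ?b * section3 0 G + ?b * section3 1 G + ?b * section3 2 G"
    by (simp add: algebra_simps)
  finally have FG: "F * G = \<dots>" .
  have s: "section3 r (section3 i F * section3 j G) =
      (if r = (i + j) mod 3 then section3 i F * section3 j G else 0)" for r i j
    by (rule section3_supported[OF supported3_mult[OF supported3_section3 supported3_section3]])
  show "section3 0 (F * G) = ?a * section3 0 G + ?b * section3 2 G"
    "section3 1 (F * G) = ?a * section3 1 G + ?b * section3 0 G"
    "section3 2 (F * G) = ?a * section3 2 G + ?b * section3 1 G"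
    unfolding FG section3_add s by simp_all
qed

text \<open>The Frobenius congruence \<open>F\<^sup>3 \<equiv> a\<^sup>3 + b\<^sup>3\<close> turns the relations between the sections into
  multiples of the unit \<open>F\<^sup>3\<close>.\<close>

lemma sections_vanish:
  fixes F G P :: "int fps"
  assumes F: "F = section3 0 F + section3 1 F" and unit: "P * F = 1"
    and one: "3 dvd section3 1 (F * G)"
    and twist: "3 dvd section3 0 F * section3 0 (F * G) - section3 1 F * section3 2 (F * G)"
  shows "3 dvd section3 0 G" and "3 dvd section3 1 G"
proof -
  define a b where "a = section3 0 F" and "b = section3 1 F"
  define G0 G1 G2 where "G0 = section3 0 G" and "G1 = section3 1 G" and "G2 = section3 2 G"
  note defs = a_def[symmetric] b_def[symmetric] G0_def[symmetric] G1_def[symmetric] G2_def[symmetric]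
  have F': "F = a + b" using F by (simp only: defs)
  have one': "3 dvd a * G1 + b * G0"
    using one unfolding section3_mult(2)[OF F] by (simp only: defs)
  have "3 dvd a * (a * G0 + b * G2) - b * (a * G2 + b * G1)"
    using twist unfolding section3_mult(1)[OF F] section3_mult(3)[OF F] by (simp only: defs)
  \<comment> \<open>The two products \<open>a * b * G2\<close> cancel, so the twist relates only
    \<open>G0\<close> and \<open>G1\<close>.\<close>
  then have twist': "3 dvd a\<^sup>2 * G0 - b\<^sup>2 * G1"
    by (simp add: power2_eq_square algebra_simps)
  have cancel: "3 dvd H" if "3 dvd (a ^ 3 + b ^ 3) * H" for H
  proof -
    have "F ^ 3 * H = (a ^ 3 + b ^ 3) * H + 3 * ((a\<^sup>2 * b + a * b\<^sup>2) * H)"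
      unfolding F' by (simp add: power3_eq_cube power2_eq_square algebra_simps)
    then have "3 dvd F ^ 3 * H" using that by (simp only: dvd_add dvd_triv_left)
    then have "3 dvd P ^ 3 * (F ^ 3 * H)" by (rule dvd_mult)
    also have "P ^ 3 * (F ^ 3 * H) = (P * F) ^ 3 * H" by (simp add: power_mult_distrib mult.assoc)
    finally show ?thesis by (simp add: unit)
  qed
  \<comment> \<open>Elimination of \<open>G1\<close>, and below of \<open>G0\<close>, from the two
    linear relations.\<close>
  have "(a ^ 3 + b ^ 3) * G0 = a * (a\<^sup>2 * G0 - b\<^sup>2 * G1) + b\<^sup>2 * (a * G1 + b * G0)"
    by (simp add: power3_eq_cube power2_eq_square algebra_simps)
  then have "3 dvd (a ^ 3 + b ^ 3) * G0" using one' twist' by (simp only: dvd_add dvd_mult)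
  then have G0: "3 dvd G0" by (rule cancel)
  have "(a ^ 3 + b ^ 3) * G1 =
      a\<^sup>2 * (a * G1 + b * G0) - a\<^sup>2 * b * G0 + a\<^sup>2 * b * G0 - b * (a\<^sup>2 * G0 - b\<^sup>2 * G1)"
    by (simp add: power3_eq_cube power2_eq_square algebra_simps)
  also have "\<dots> = a\<^sup>2 * (a * G1 + b * G0) - b * (a\<^sup>2 * G0 - b\<^sup>2 * G1)" by simp
  finally have "3 dvd (a ^ 3 + b ^ 3) * G1" using one' twist' by (simp only: dvd_diff dvd_mult)
  then have "3 dvd G1" by (rule cancel)
  with G0 show "3 dvd section3 0 G" "3 dvd section3 1 G" by (simp_all only: G0_def G1_def)
qed

section \<open>The divisor series modulo 3\<close>

lemma factor_pairs_fold:
  fixes f :: "nat \<Rightarrow> nat \<Rightarrow> int"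
  assumes "\<And>j. f j j = 0"
  shows "(\<Sum>(j, k)\<in>factor_pairs i. f j k) = (\<Sum>(j, k)\<in>factor_pairs i. of_bool (j < k) * (f j k + f k j))"
proof -
  have "(\<Sum>(j, k)\<in>factor_pairs i. f j k) =
      (\<Sum>(j, k)\<in>factor_pairs i. of_bool (j < k) * f j k) + (\<Sum>(j, k)\<in>factor_pairs i. of_bool (k < j) * f j k)"
    unfolding case_prod_unfold sum.distrib[symmetric]
  proof (rule sum.cong[OF refl])
    fix t :: "nat \<times> nat"
    show "f (fst t) (snd t) = of_bool (fst t < snd t) * f (fst t) (snd t) + of_bool (snd t < fst t) * f (fst t) (snd t)"
      by (cases "fst t" "snd t" rule: linorder_cases) (simp_all add: assms)
  qed
  also have "(\<Sum>(j, k)\<in>factor_pairs i. of_bool (k < j) * f j k) = (\<Sum>(j, k)\<in>factor_pairs i. of_bool (j < k) * f k j)"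
    by (rule sum.reindex_bij_witness[of _ prod.swap prod.swap]) (auto simp: factor_pairs_def mult.commute)
  finally show ?thesis by (simp add: case_prod_unfold sum.distrib distrib_left)
qed

definition divisor_series :: "int fps" where
  "divisor_series = 2 * (gap_series + parity_series)"

text \<open>Folding the parity series onto \<open>d < e\<close> gives both series the common factor
  \<open>e - d\<close>. Since (-1)^d is congruent to 1 plus the parity of \<open>d\<close>, the
  dependence on \<open>d\<close> cancels and (-1)^e remains.\<close>

lemma divisor_series_cong:
  "[divisor_series $ i = - (\<Sum>(d, e)\<in>{(d, e) \<in> factor_pairs i. d < e}. (-1) ^ e * (int e - int d))] (mod 3)"
proof -
  have "divisor_series $ i = 2 * (gap_series $ i + parity_series $ i)"
    by (simp only: divisor_series_def double_fps_nth fps_add_nth)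
  also have "\<dots> = (\<Sum>(d, e)\<in>factor_pairs i. of_bool (d < e) *
      (2 * ((-1) ^ d + of_bool (odd e) - of_bool (odd d)) * (int e - int d)))"
    unfolding gap_series_def parity_series_def fps_nth_Abs_fps
    by (subst factor_pairs_fold)
      (simp_all add: case_prod_unfold sum.distrib[symmetric] sum_distrib_left algebra_simps)
  also have "\<dots> = (\<Sum>(d, e)\<in>{(d, e) \<in> factor_pairs i. d < e}.
      2 * ((-1) ^ d + of_bool (odd e) - of_bool (odd d)) * (int e - int d))"
    by (rule sum.mono_neutral_cong_right[OF finite_factor_pairs]) auto
  also have "[\<dots> = (\<Sum>(d, e)\<in>{(d, e) \<in> factor_pairs i. d < e}. - ((-1) ^ e) * (int e - int d))] (mod 3)"
    unfolding case_prod_unfold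
  proof (intro cong_sum cong_mult cong_refl)
    fix t :: "nat \<times> nat"
    show "[2 * ((-1) ^ fst t + of_bool (odd (snd t)) - of_bool (odd (fst t))) = - ((-1) ^ snd t)] (mod (3::int))"
      by (cases "even (fst t)"; cases "even (snd t)") (simp_all add: cong_def)
  qed
  also have "(\<Sum>(d, e)\<in>{(d, e) \<in> factor_pairs i. d < e}. - ((-1) ^ e) * (int e - int d)) =
      - (\<Sum>(d, e)\<in>{(d, e) \<in> factor_pairs i. d < e}. (-1) ^ e * (int e - int d))"
    by (simp add: case_prod_unfold sum_negf)
  finally show ?thesis .
qed

text \<open>If \<open>d * e\<close> is 1 modulo 3, then \<open>d\<close> and \<open>e\<close> are
  congruent, so every \<open>e - d\<close> is divisible by 3.\<close>

lemma divisor_series_1_mod_3: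
  assumes "i mod 3 = 1" shows "3 dvd divisor_series $ i"
proof -
  have "3 dvd (\<Sum>(d, e)\<in>{(d, e) \<in> factor_pairs i. d < e}. (-1) ^ e * (int e - int d))"
  proof (rule dvd_sum)
    fix t assume "t \<in> {(d, e) \<in> factor_pairs i. d < e}"
    then obtain d e where t: "t = (d, e)" "d * e = i" by (auto simp: factor_pairs_def)
    have "((d mod 3) * (e mod 3)) mod 3 = 1" using assms t(2) by (simp add: mod_mult_eq)
    moreover have "d mod 3 \<in> {0, 1, 2}" "e mod 3 \<in> {0, 1, 2}" by auto
    ultimately have "d mod 3 = e mod 3" by auto
    then have "int e mod 3 = int d mod 3" by (metis of_nat_mod of_nat_numeral)
    then have "3 dvd int e - int d" by (simp add: mod_eq_dvd_iff)
    then show "3 dvd (case t of (d, e) \<Rightarrow> (-1) ^ e * (int e - int d))" by (simp add: t)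
  qed
  then show ?thesis using cong_dvd_iff[OF divisor_series_cong[of i]] by simp
qed

section \<open>The theta series and the twisted product\<close>

definition theta :: "int fps" where
  "theta = 1 - 2 * signed_theta 0"

lemma theta_nth: "theta $ i = (\<Sum>x\<in>{x \<in> {- int i..int i}. x\<^sup>2 = int i}. int_sgn x)"
proof (cases "i = 0")
  case True
  have "{x \<in> {- int 0..int 0}. x\<^sup>2 = int 0} = {0}" by auto
  then show ?thesis unfolding True by (simp add: theta_def signed_theta_def int_sgn_def double_fps_nth)
next
  case False
  have sq: "n * n = i \<longleftrightarrow> (int n)\<^sup>2 = int i" for n
    unfolding power2_eq_square of_nat_mult[symmetric] of_nat_eq_iff ..
  have "theta $ i = 2 * (\<Sum>n=1..i. of_bool (n * n = i) * (-1) ^ n)"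
    using False by (simp add: theta_def signed_theta_def double_fps_nth sum_negf)
  also have "(\<Sum>n=1..i. of_bool (n * n = i) * (-1) ^ n) = (\<Sum>n\<in>{n \<in> {1..i}. n * n = i}. (-1) ^ n :: int)"
    by (rule sum.mono_neutral_cong_right) auto
  also have "2 * \<dots> = (\<Sum>x\<in>{x \<in> {1..int i}. x\<^sup>2 = int i}. int_sgn x) + (\<Sum>x\<in>{x \<in> {- int i..-1}. x\<^sup>2 = int i}. int_sgn x)"
  proof -
    have "(\<Sum>n\<in>{n \<in> {1..i}. n * n = i}. (-1) ^ n) = (\<Sum>x\<in>{x \<in> {1..int i}. x\<^sup>2 = int i}. int_sgn x)"
      by (rule sum.reindex_bij_witness[of _ nat int]) (auto simp: sq int_sgn_def uminus_power_if nat_power_eq[symmetric] even_nat_iff)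
    moreover have "(\<Sum>x\<in>{x \<in> {1..int i}. x\<^sup>2 = int i}. int_sgn x) = (\<Sum>x\<in>{x \<in> {- int i..-1}. x\<^sup>2 = int i}. int_sgn x)"
      by (rule sum.reindex_bij_witness[of _ uminus uminus]) (auto simp: int_sgn_def)
    ultimately show ?thesis by simp
  qed
  also have "\<dots> = (\<Sum>x\<in>{x \<in> {- int i..int i}. x\<^sup>2 = int i}. int_sgn x)"
  proof -
    have "{x \<in> {- int i..int i}. x\<^sup>2 = int i} = {x \<in> {1..int i}. x\<^sup>2 = int i} \<union> {x \<in> {- int i..-1}. x\<^sup>2 = int i}"
    proof -
      have "x \<noteq> 0" if "x\<^sup>2 = int i" for x using False that by auto
      then show ?thesis by (auto, fastforce)
    qed
    moreover have "finite {x \<in> {1..int i}. x\<^sup>2 = int i}" "finite {x \<in> {- int i..-1}. x\<^sup>2 = int i}"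
      by (rule finite_subset[of _ "{- int i..int i}"]; auto)+
    ultimately show ?thesis by (simp only:) (rule sum.union_disjoint[symmetric]; auto)
  qed
  finally show ?thesis .
qed

lemma square_mod_3: "(x::int)\<^sup>2 mod 3 = (if 3 dvd x then 0 else 1)"
proof -
  have sq: "x\<^sup>2 mod 3 = r\<^sup>2 mod 3" if "x mod 3 = r" for r
    unfolding that[symmetric] by (simp only: power_mod)
  have "x mod 3 = 0 \<or> x mod 3 = 1 \<or> x mod 3 = 2" by presburger
  then consider "x mod 3 = 0" | "x mod 3 = 1" | "x mod 3 = 2" by blast
  then show ?thesis
  proof cases
    case 1
    then show ?thesis using sq[OF 1] by (simp add: dvd_eq_mod_eq_0)
  next
    case 2
    then show ?thesis using sq[OF 2] by (simp add: dvd_eq_mod_eq_0)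
  next
    case 3
    then show ?thesis using sq[OF 3] by (simp add: dvd_eq_mod_eq_0)
  qed
qed

lemma theta_sections: "theta = section3 0 theta + section3 1 theta"
proof -
  have zero: "section3 2 theta = 0"
  proof (rule fps_ext)
    fix n
    show "section3 2 theta $ n = 0 $ n"
    proof (cases "n mod 3 = 2")
      case True
      have "x\<^sup>2 \<noteq> int n" for x
      proof
        assume "x\<^sup>2 = int n"
        then have "int n mod 3 = 0 \<or> int n mod 3 = 1" using square_mod_3[of x] by (auto split: if_splits)
        then show False using True by presburger
      qed
      then show ?thesis by (simp add: section3_nth theta_nth)
    qed (simp add: section3_nth)
  qed
  show ?thesis by (rule section3_sum[THEN trans]) (simp only: zero add_0_right)
qed

text \<open>At a multiple of 3 the coefficient is a sum over \<open>x\<^sup>2 + d * e = N\<close>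
  with \<open>d < e\<close>; modulo 3 the sign between the two products becomes the factor
  \<open>1 + x\<^sup>2\<close> of the genus character. At other exponents both products
  vanish.\<close>

lemma theta_twist:
  "3 dvd section3 0 theta * section3 0 divisor_series - section3 1 theta * section3 2 divisor_series"
  unfolding fps_3_dvd_iff
proof
  fix N
  let ?a = "section3 0 theta" and ?b = "section3 1 theta" and ?U = divisor_series
  show "3 dvd (?a * section3 0 ?U - ?b * section3 2 ?U) $ N"
  proof (cases "N mod 3 = 0")
    case False
    have "supported3 0 (?a * section3 0 ?U)" "supported3 0 (?b * section3 2 ?U)"
      using supported3_mult[OF supported3_section3[of 0 theta] supported3_section3[of 0 ?U]]
        supported3_mult[OF supported3_section3[of 1 theta] supported3_section3[of 2 ?U]] by simp_all
    then show ?thesis using False by (simp add: supported3_def)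
  next
    case True
    define X where "X i = {x \<in> {- int i..int i}. x\<^sup>2 = int i}" for i
    define D where "D i = {(d, e) \<in> factor_pairs i. d < e}" for i
    have fin: "finite (X i)" "finite (D i)" for i
    proof -
      have "X i \<subseteq> {- int i..int i}" "D i \<subseteq> factor_pairs i" by (auto simp: X_def D_def)
      then show "finite (X i)" "finite (D i)"
        using finite_factor_pairs finite_subset finite_atLeastAtMost_int by blast+
    qed
    have "(?a * section3 0 ?U - ?b * section3 2 ?U) $ N =
        (\<Sum>i=0..N. ?a $ i * section3 0 ?U $ (N - i) - ?b $ i * section3 2 ?U $ (N - i))"
      by (simp add: fps_mult_nth sum_subtractf)
    also have "[\<dots> = (\<Sum>i=0..N. - (\<Sum>x\<in>X i. \<Sum>(d, e)\<in>D (N - i). int_sgn (x + int e) * ((1 + x\<^sup>2) * (int e - int d))))] (mod 3)"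
    proof (rule cong_sum)
      fix i assume "i \<in> {0..N}"
      \<comment> \<open>A square \<open>i = x\<^sup>2\<close> is 0 or 1 modulo 3, so this sign is
        congruent to \<open>1 + x\<^sup>2\<close>.\<close>
      define \<epsilon> :: int where "\<epsilon> = (if i mod 3 = 0 then 1 else -1)"
      have N: "i mod 3 = 1 \<longleftrightarrow> (N - i) mod 3 = 2" "i mod 3 = 0 \<longleftrightarrow> (N - i) mod 3 = 0"
      proof -
        have "(i + m) mod 3 = 0 \<Longrightarrow> (i mod 3 = 1 \<longleftrightarrow> m mod 3 = 2) \<and> (i mod 3 = 0 \<longleftrightarrow> m mod 3 = 0)" for m :: nat
          by presburger
        moreover have "i + (N - i) = N" using \<open>i \<in> {0..N}\<close> by simp
        ultimately show "i mod 3 = 1 \<longleftrightarrow> (N - i) mod 3 = 2" "i mod 3 = 0 \<longleftrightarrow> (N - i) mod 3 = 0"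
          using True by (metis (no_types))+
      qed
      have "?a $ i * section3 0 ?U $ (N - i) - ?b $ i * section3 2 ?U $ (N - i) =
          (\<epsilon> * theta $ i) * ?U $ (N - i)"
      proof -
        have "theta $ i = ?a $ i + ?b $ i" using theta_sections by (metis fps_add_nth)
        then have "theta $ i = 0" if "i mod 3 \<noteq> 0" "i mod 3 \<noteq> 1" using that by (simp add: section3_nth)
        then show ?thesis using N by (auto simp: section3_nth \<epsilon>_def)
      qed
      also have "[\<dots> = (\<Sum>x\<in>X i. int_sgn x * (1 + x\<^sup>2)) * - (\<Sum>(d, e)\<in>D (N - i). (-1) ^ e * (int e - int d))] (mod 3)"
      proof (rule cong_mult)
        show "[?U $ (N - i) = - (\<Sum>(d, e)\<in>D (N - i). (-1) ^ e * (int e - int d))] (mod 3)"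
          unfolding D_def by (rule divisor_series_cong)
        have "[(\<Sum>x\<in>X i. int_sgn x * \<epsilon>) = (\<Sum>x\<in>X i. int_sgn x * (1 + x\<^sup>2))] (mod 3)"
        proof (intro cong_sum cong_mult cong_refl)
          fix x assume "x \<in> X i"
          then have x: "x\<^sup>2 = int i" by (simp add: X_def)
          then have "int i mod 3 = (if 3 dvd x then 0 else 1)" using square_mod_3[of x] by simp
          moreover have "int i mod 3 = int (i mod 3)" by (simp add: of_nat_mod)
          ultimately have "i mod 3 = 0 \<and> int i mod 3 = 0 \<or> i mod 3 = 1 \<and> int i mod 3 = 1" by (auto split: if_splits)
          then have "\<epsilon> mod 3 = (1 + int i) mod 3"
          proof
            assume "i mod 3 = 0 \<and> int i mod 3 = 0"
            then show ?thesis unfolding \<epsilon>_def by presburger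
          next
            assume "i mod 3 = 1 \<and> int i mod 3 = 1"
            then have "\<epsilon> = -1" "(1 + int i) mod 3 = 2" unfolding \<epsilon>_def by (simp, presburger)
            then show ?thesis by simp
          qed
          then show "[\<epsilon> = 1 + x\<^sup>2] (mod 3)" by (simp only: cong_def x)
        qed
        then show "[\<epsilon> * theta $ i = (\<Sum>x\<in>X i. int_sgn x * (1 + x\<^sup>2))] (mod 3)"
          unfolding theta_nth X_def by (simp add: sum_distrib_left mult.commute)
      qed
      also have "(\<Sum>x\<in>X i. int_sgn x * (1 + x\<^sup>2)) * - (\<Sum>(d, e)\<in>D (N - i). (-1) ^ e * (int e - int d)) =
          - (\<Sum>x\<in>X i. \<Sum>(d, e)\<in>D (N - i). int_sgn (x + int e) * ((1 + x\<^sup>2) * (int e - int d)))"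
      proof -
        have "int_sgn (x + int e) = int_sgn x * (-1) ^ e" for x e
          by (simp add: int_sgn_def uminus_power_if)
        then show ?thesis
          by (simp add: sum_product case_prod_unfold mult_ac)
      qed
      finally show "[?a $ i * section3 0 ?U $ (N - i) - ?b $ i * section3 2 ?U $ (N - i) =
        - (\<Sum>x\<in>X i. \<Sum>(d, e)\<in>D (N - i). int_sgn (x + int e) * ((1 + x\<^sup>2) * (int e - int d)))] (mod 3)" .
    qed
    also have "(\<Sum>i=0..N. - (\<Sum>x\<in>X i. \<Sum>(d, e)\<in>D (N - i). int_sgn (x + int e) * ((1 + x\<^sup>2) * (int e - int d)))) =
        - (\<Sum>(i, x, d, e)\<in>(SIGMA i:{0..N}. X i \<times> D (N - i)). int_sgn (x + int e) * ((1 + x\<^sup>2) * (int e - int d)))"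
      by (simp add: sum_negf sum.Sigma fin sum.cartesian_product case_prod_unfold)
    \<comment> \<open>The exponent \<open>i\<close> is recovered as \<open>x\<^sup>2\<close>, so the
      quadruples correspond to the indefinite forms.\<close>
    also have "(\<Sum>(i, x, d, e)\<in>(SIGMA i:{0..N}. X i \<times> D (N - i)). int_sgn (x + int e) * ((1 + x\<^sup>2) * (int e - int d))) =
        (\<Sum>(d, x, e)\<in>{(d, x, e) \<in> indef_forms (int N). d < e}. int_sgn (x + e) * ((1 + x\<^sup>2) * (e - d)))"
    proof (rule sum.reindex_bij_witness[of _ "\<lambda>(d, x, e). (nat (x\<^sup>2), x, nat d, nat e)" "\<lambda>(i, x, d, e). (int d, x, int e)"])
      fix t assume "t \<in> (SIGMA i:{0..N}. X i \<times> D (N - i))"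
      then obtain i x d e where t: "t = (i, x, d, e)" "i \<le> N" "x\<^sup>2 = int i" "0 < d" "d < e" "d * e = N - i"
        by (auto simp: X_def D_def factor_pairs_def)
      then have "int d * int e = int N - int i" by (metis of_nat_diff of_nat_mult)
      then show "(case t of (i, x, d, e) \<Rightarrow> (int d, x, int e)) \<in> {(d, x, e) \<in> indef_forms (int N). d < e}"
        "(case case t of (i, x, d, e) \<Rightarrow> (int d, x, int e) of (d, x, e) \<Rightarrow> (nat (x\<^sup>2), x, nat d, nat e)) = t"
        using t by (auto simp: indef_forms_def)
    next
      fix t assume "t \<in> {(d, x, e) \<in> indef_forms (int N). d < e}"
      then obtain d x e where t: "t = (d, x, e)" "0 < d" "d < e" "x\<^sup>2 + d * e = int N"
        by (auto simp: indef_forms_def)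
      define i where "i = nat (x\<^sup>2)"
      have i: "int i = x\<^sup>2" by (simp add: i_def)
      have "0 < d * e" using t by simp
      then have "i \<le> N" using t(4) i by linarith
      have "int (nat d * nat e) = int (N - i)"
        using t i \<open>i \<le> N\<close> by (simp add: of_nat_diff)
      then have de: "nat d * nat e = N - i" by (simp only: of_nat_eq_iff)
      have "\<bar>x\<bar> \<le> x\<^sup>2" by (rule abs_le_square_int)
      then have "x \<in> X i" unfolding X_def i by auto
      then show "(case t of (d, x, e) \<Rightarrow> (nat (x\<^sup>2), x, nat d, nat e)) \<in> (SIGMA i:{0..N}. X i \<times> D (N - i))"
        using t \<open>i \<le> N\<close> de by (auto simp: D_def factor_pairs_def i_def[symmetric])
      show "(case case t of (d, x, e) \<Rightarrow> (nat (x\<^sup>2), x, nat d, nat e) of (i, x, d, e) \<Rightarrow> (int d, x, int e)) = t"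
        using t by simp
    qed auto
    finally have "[(?a * section3 0 ?U - ?b * section3 2 ?U) $ N =
        - (\<Sum>(d, x, e)\<in>{(d, x, e) \<in> indef_forms (int N). d < e}. int_sgn (x + e) * ((1 + x\<^sup>2) * (e - d)))] (mod 3)" .
    moreover have "3 dvd (\<Sum>(d, x, e)\<in>{(d, x, e) \<in> indef_forms (int N). d < e}. int_sgn (x + e) * ((1 + x\<^sup>2) * (e - d)))"
    proof (rule indef_forms_signed_sum_cong)
      show "3 dvd int N" using True by presburger
    qed
    ultimately show ?thesis by (simp only: cong_dvd_iff dvd_minus_iff)
  qed
qed

text \<open>As \<open>op_gf\<close> inverts \<open>theta\<close>, multiplying this product by
  \<open>theta\<close> gives back \<open>divisor_series\<close>, whose two divisibilities feed
  \<open>sections_vanish\<close>.\<close>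

lemma op_gf_divisor_series:
  assumes "N mod 3 = 0 \<or> N mod 3 = 1"
  shows "3 dvd (op_gf * divisor_series) $ N"
proof -
  have unit: "op_gf * theta = 1" using op_gf_theta by (simp only: theta_def)
  have prod: "theta * (op_gf * divisor_series) = divisor_series"
    using unit by (metis mult.assoc mult.commute mult_1)
  have "3 dvd section3 1 divisor_series"
    unfolding fps_3_dvd_iff section3_nth by (simp add: divisor_series_1_mod_3)
  then have "3 dvd section3 0 (op_gf * divisor_series)" "3 dvd section3 1 (op_gf * divisor_series)"
    using sections_vanish[OF theta_sections unit, of "op_gf * divisor_series"] theta_twist by (simp_all only: prod)
  then have "3 dvd section3 (N mod 3) (op_gf * divisor_series)" using assms by auto
  then show ?thesis unfolding fps_3_dvd_iff section3_nth by metis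
qed

text \<open>Write l - 2 n_o as (l - n) + (n - 2 n_o), for which both generating functions are
  known.\<close>

lemma sum_size_largest_odd:
  assumes "N mod 3 = 0 \<or> N mod 3 = 1"
  shows "3 dvd (\<Sum>M\<in>over_msets N. int (size M) * (int (largest M) - 2 * int (num_odd M)))"
proof -
  have "(\<Sum>M\<in>over_msets N. int (size M) * (int (largest M) - 2 * int (num_odd M))) =
      (2 * op_gf * gap_series) $ N + (2 * op_gf * parity_series) $ N"
    unfolding sum_size_rank_gf[symmetric] sum_size_minus_odd_gf[symmetric] sum.distrib[symmetric]
    by (rule sum.cong[OF refl]) (simp add: algebra_simps)
  also have "\<dots> = (op_gf * divisor_series) $ N"
    unfolding divisor_series_def fps_add_nth[symmetric] by (simp only: algebra_simps)
  finally show ?thesis using op_gf_divisor_series[OF assms] by simp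
qed

section \<open>Return to the two ranks\<close>

definition toggle_head :: "part list \<Rightarrow> part list" where
  "toggle_head \<pi> = (case \<pi> of [] \<Rightarrow> [] | p # \<pi>' \<Rightarrow> (fst p, \<not> snd p) # \<pi>')"

text \<open>The head is always the first occurrence of its size, and the conditions on later parts
  see only its size.\<close>

lemma overpartition_head_flag: "overpartition N ((k, b) # \<pi>) \<longleftrightarrow> overpartition N ((k, c) # \<pi>)"
  unfolding overpartition_def by (simp add: All_less_Suc2)

lemma toggle_head_overpartitions: "\<pi> \<in> overpartitions N \<Longrightarrow> toggle_head \<pi> \<in> overpartitions N"
  unfolding overpartitions_def toggle_head_def mem_Collect_eq
  by (cases \<pi>) (auto intro: overpartition_head_flag[THEN iffD1])

lemma toggle_head_twice: "toggle_head (toggle_head \<pi>) = \<pi>"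
  by (cases \<pi>) (simp_all add: toggle_head_def)

lemma ceiling_half: "\<lceil>real k / 2\<rceil> = (int k + 1) div 2"
proof (cases "even k")
  case True
  then obtain m where "k = 2 * m" by (rule evenE)
  then show ?thesis by simp
next
  case False
  then obtain m where m: "k = 2 * m + 1" by (rule oddE)
  have "\<lceil>real k / 2\<rceil> = int m + 1" unfolding m by (rule ceiling_unique) simp_all
  then show ?thesis using m by simp
qed

lemma sum_floor_half_largest:
  "2 * (\<Sum>\<pi>\<in>overpartitions N. int (num_parts \<pi>) * (int (largest_part \<pi>) - \<lceil>real (largest_part \<pi>) / 2\<rceil> + chi \<pi>)) =
     (\<Sum>\<pi>\<in>overpartitions N. int (num_parts \<pi>) * int (largest_part \<pi>))"
proof -
  define v where "v \<pi> = int (largest_part \<pi>) - \<lceil>real (largest_part \<pi>) / 2\<rceil> + chi \<pi>" for \<pi>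
  \<comment> \<open>Without \<open>chi\<close> each of the two terms is the floor of half the
    largest part. For odd size exactly one of the two flags has \<open>chi\<close> equal to 1, which
    restores the lost unit.\<close>
  have v: "v \<pi> + v (toggle_head \<pi>) = int (largest_part \<pi>)" for \<pi>
  proof (cases \<pi>)
    case (Cons p \<pi>')
    obtain k b where p: "p = (k, b)" by (cases p)
    show ?thesis
      by (cases "even k"; cases b)
        (auto simp: v_def Cons p toggle_head_def largest_part_def chi_def odd_nonoverlined_def ceiling_half
          elim!: evenE oddE)
  qed (simp add: v_def toggle_head_def largest_part_def chi_def)
  have "num_parts (toggle_head \<pi>) = num_parts \<pi>" for \<pi>
    by (cases \<pi>) (simp_all add: toggle_head_def num_parts_def)
  then have "(\<Sum>\<pi>\<in>overpartitions N. int (num_parts \<pi>) * v \<pi>) =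
      (\<Sum>\<pi>\<in>overpartitions N. int (num_parts \<pi>) * v (toggle_head \<pi>))"
    by (intro sum.reindex_bij_witness[of _ toggle_head toggle_head])
      (simp_all add: toggle_head_twice toggle_head_overpartitions)
  then have "2 * (\<Sum>\<pi>\<in>overpartitions N. int (num_parts \<pi>) * v \<pi>) =
      (\<Sum>\<pi>\<in>overpartitions N. int (num_parts \<pi>) * (v \<pi> + v (toggle_head \<pi>)))"
    by (simp add: distrib_left sum.distrib)
  then show ?thesis unfolding v by (simp only: v_def)
qed

text \<open>Modulo 3 the indicator of residue 1 minus that of residue 2 is congruent to the rank
  itself.\<close>

lemma rank_difference_cong:
  fixes r :: "part list \<Rightarrow> int"
  assumes "finite A"
  shows "[(\<Sum>\<pi> | \<pi> \<in> A \<and> [r \<pi> = 1] (mod 3). w \<pi>) - (\<Sum>\<pi> | \<pi> \<in> A \<and> [r \<pi> = 2] (mod 3). w \<pi>)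
      = (\<Sum>\<pi>\<in>A. w \<pi> * r \<pi>)] (mod 3)"
proof -
  have "(\<Sum>\<pi> | \<pi> \<in> A \<and> [r \<pi> = c] (mod 3). w \<pi>) = (\<Sum>\<pi>\<in>A. w \<pi> * of_bool ([r \<pi> = c] (mod 3)))" for c
    by (rule sum.mono_neutral_cong_left) (use assms in auto)
  then have "(\<Sum>\<pi> | \<pi> \<in> A \<and> [r \<pi> = 1] (mod 3). w \<pi>) - (\<Sum>\<pi> | \<pi> \<in> A \<and> [r \<pi> = 2] (mod 3). w \<pi>)
      = (\<Sum>\<pi>\<in>A. w \<pi> * (of_bool ([r \<pi> = 1] (mod 3)) - of_bool ([r \<pi> = 2] (mod 3))))"
    by (simp add: sum_subtractf right_diff_distrib)
  also have "[\<dots> = (\<Sum>\<pi>\<in>A. w \<pi> * r \<pi>)] (mod 3)"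
  proof (intro cong_sum cong_mult cong_refl)
    fix \<pi>
    have "r \<pi> mod 3 = 0 \<or> r \<pi> mod 3 = 1 \<or> r \<pi> mod 3 = 2" by presburger
    then show "[of_bool ([r \<pi> = 1] (mod 3)) - of_bool ([r \<pi> = 2] (mod 3)) = r \<pi>] (mod 3)"
      by (auto simp: cong_def)
  qed
  finally show ?thesis .
qed

lemma NT_bar_cong_NT2_bar:
  assumes "N mod 3 = 0 \<or> N mod 3 = 1"
  shows "[NT_bar 1 3 N - NT_bar 2 3 N = NT2_bar 1 3 N - NT2_bar 2 3 N] (mod 3)"
proof -
  define A where "A = (\<Sum>\<pi>\<in>overpartitions N. int (num_parts \<pi>) * dyson_rank \<pi>)"
  define B where "B = (\<Sum>\<pi>\<in>overpartitions N. int (num_parts \<pi>) * M2_rank \<pi>)"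
  define C where "C = (\<Sum>\<pi>\<in>overpartitions N. int (num_parts \<pi>) * int (num_parts (odd_nonoverlined_parts \<pi>)))"
  \<comment> \<open>The number of parts cancels in the difference of the two ranks.\<close>
  have "A - B = (\<Sum>\<pi>\<in>overpartitions N. int (num_parts \<pi>) * (int (largest_part \<pi>) - \<lceil>real (largest_part \<pi>) / 2\<rceil> + chi \<pi>)) - C"
    unfolding A_def B_def C_def sum_subtractf[symmetric]
    by (rule sum.cong[OF refl]) (simp add: dyson_rank_def M2_rank_def algebra_simps)
  then have "2 * (A - B) = (\<Sum>\<pi>\<in>overpartitions N. int (num_parts \<pi>) * int (largest_part \<pi>)) - 2 * C"
    using sum_floor_half_largest[of N] by simp
  also have "\<dots> = (\<Sum>\<pi>\<in>overpartitions N. int (num_parts \<pi>) *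
      (int (largest_part \<pi>) - 2 * int (num_parts (odd_nonoverlined_parts \<pi>))))"
    by (simp add: C_def sum_distrib_left sum_subtractf[symmetric] algebra_simps)
  also have "\<dots> = (\<Sum>M\<in>over_msets N. int (size M) * (int (largest M) - 2 * int (num_odd M)))"
    by (rule sum_overpartitions[of "\<lambda>l n o'. int n * (int l - 2 * int o')"])
  finally have "3 dvd 2 * (A - B)" using sum_size_largest_odd[OF assms] by simp
  then have "3 dvd A - B" by presburger
  then have "[A = B] (mod 3)" by (simp add: cong_iff_dvd_diff)
  moreover have "[NT_bar 1 3 N - NT_bar 2 3 N = A] (mod 3)"
    unfolding NT_bar_def A_def by (rule rank_difference_cong[OF finite_overpartitions])
  moreover have "[NT2_bar 1 3 N - NT2_bar 2 3 N = B] (mod 3)"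
    unfolding NT2_bar_def B_def by (rule rank_difference_cong[OF finite_overpartitions])
  ultimately show ?thesis by (meson cong_sym cong_trans)
qed

theorem theorem1p2:
  fixes n :: nat
  shows "[NT_bar 1 3 (3 * n) - NT_bar 2 3 (3 * n)
            = NT2_bar 1 3 (3 * n) - NT2_bar 2 3 (3 * n)] (mod 3) \<and>
         [NT_bar 1 3 (3 * n + 1) - NT_bar 2 3 (3 * n + 1)
            = NT2_bar 1 3 (3 * n + 1) - NT2_bar 2 3 (3 * n + 1)] (mod 3)"
  by (intro conjI NT_bar_cong_NT2_bar) presburger+

end
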